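(* Let $(p_n)$ and $(q_n)$ be arbitrary sequences of positive integers with $\max(p_n,q_n)\to+\infty$. Let $(\mathbf{X}_{ni}',\mathbf{Y}_{ni}')'$, $i=1,\ldots,n$, $n=1,2,\ldots$, be a triangular array such that, for each $n$, the random vectors $(\mathbf{X}_{ni}',\mathbf{Y}_{ni}')'$, $i=1,\ldots,n$, are i.i.d., with $\mathbf{X}_{ni}\in\mathbb{R}^{p_n}$ and $\mathbf{Y}_{ni}\in\mathbb{R}^{q_n}$ independent and having spherical directions in $\mathbb{R}^{p_n}$ and $\mathbb{R}^{q_n}$ respectively. Let $\mathbf{U}_{ni}=\mathbf{X}_{ni}/\|\mathbf{X}_{ni}\|$, $\mathbf{V}_{ni}=\mathbf{Y}_{ni}/\|\mathbf{Y}_{ni}\|$ and $I_n=\frac{p_nq_n}{n}\sum_{i,j=1}^n(\mathbf{U}_{ni}'\mathbf{U}_{nj})(\mathbf{V}_{ni}'\mathbf{V}_{nj})$. Then $$I_n^{\rm St}=\frac{I_n-p_nq_n}{\sqrt{2p_nq_n}}=\frac{\sqrt{2p_nq_n}}{n}\sum_{1\le i<j\le n}(\mathbf{U}_{ni}'\mathbf{U}_{nj})(\mathbf{V}_{ni}'\mathbf{V}_{nj})$$ converges in distribution to the standard normal distribution as $n\to\infty$.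
   Context: A distribution on $\mathbb{R}^p$ has spherical directions if it puts no mass at the origin and, for $\mathbf{X}$ with this distribution, $\mathbf{X}/\|\mathbf{X}\|$ is uniformly distributed on the unit sphere $\mathcal{S}^{p-1}$. *)

theory Defs
  imports "HOL-Probability.Probability"
begin

text \<open>Vectors of \<open>R^p\<close> are represented as elements of the product space
  \<open>PiM {..<p} (\<lambda>_. borel)\<close> (extensional functions on \<open>{..<p}\<close>).\<close>

definition Rspace :: "nat \<Rightarrow> (nat \<Rightarrow> real) measure" where
  "Rspace p = PiM {..<p} (\<lambda>_. borel)"

definition leb :: "nat \<Rightarrow> (nat \<Rightarrow> real) measure" where
  "leb p = PiM {..<p} (\<lambda>_. lborel)"

definition vinner :: "nat \<Rightarrow> (nat \<Rightarrow> real) \<Rightarrow> (nat \<Rightarrow> real) \<Rightarrow> real" where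
  "vinner p x y = (\<Sum>i<p. x i * y i)"

definition vnorm :: "nat \<Rightarrow> (nat \<Rightarrow> real) \<Rightarrow> real" where
  "vnorm p x = sqrt (\<Sum>i<p. (x i)\<^sup>2)"

definition direction :: "nat \<Rightarrow> (nat \<Rightarrow> real) \<Rightarrow> (nat \<Rightarrow> real)" where
  "direction p x = (\<lambda>i\<in>{..<p}. x i / vnorm p x)"

definition unit_ball :: "nat \<Rightarrow> (nat \<Rightarrow> real) set" where
  "unit_ball p = {x \<in> space (leb p). vnorm p x \<le> 1}"

text \<open>Uniform distribution on the unit sphere \<open>S^{p-1}\<close>: the normalized cone measure,
  i.e. \<open>\<sigma>(A) = \<lambda>({t u : u \<in> A, 0 < t \<le> 1}) / \<lambda>(B)\<close>, written as the image of the
  uniform distribution on the unit ball under radial projection.\<close>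
definition uniform_sphere :: "nat \<Rightarrow> (nat \<Rightarrow> real) measure" where
  "uniform_sphere p = distr (uniform_measure (leb p) (unit_ball p)) (Rspace p) (direction p)"

definition spherical_directions :: "nat \<Rightarrow> (nat \<Rightarrow> real) measure \<Rightarrow> bool" where
  "spherical_directions p P \<longleftrightarrow>
     prob_space P \<and> sets P = sets (Rspace p) \<and>
     emeasure P {x \<in> space (Rspace p). \<forall>i<p. x i = 0} = 0 \<and>
     distr P (Rspace p) (direction p) = uniform_sphere p"

definition I_stat :: "nat \<Rightarrow> nat \<Rightarrow> nat \<Rightarrow> (nat \<Rightarrow> nat \<Rightarrow> real) \<Rightarrow> (nat \<Rightarrow> nat \<Rightarrow> real) \<Rightarrow> real" where
  "I_stat p q n U V = real (p * q) / real n *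
     (\<Sum>i<n. \<Sum>j<n. vinner p (U i) (U j) * vinner q (V i) (V j))"

definition I_St :: "nat \<Rightarrow> nat \<Rightarrow> nat \<Rightarrow> (nat \<Rightarrow> nat \<Rightarrow> real) \<Rightarrow> (nat \<Rightarrow> nat \<Rightarrow> real) \<Rightarrow> real" where
  "I_St p q n U V = (I_stat p q n U V - real (p * q)) / sqrt (2 * real (p * q))"

end

theory Submission
  imports Defs
begin

text \<open>
  Put \<open>W\<^sub>i = U\<^sub>i \<otimes> V\<^sub>i\<close>, a unit vector of dimension \<open>d = p q\<close> with mean \<open>0\<close>, covariance \<open>I / d\<close> and
  \<open>E\<langle>T, W\<^sub>i\<rangle>\<^sup>4 \<le> 9 |T|\<^sup>4 / d\<^sup>2\<close>. With \<open>T\<^sub>j = W\<^sub>0 + \<dots> + W\<^sub>j\<^sub>-\<^sub>1\<close> the statistic is a sum of the martingale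
  differences \<open>D\<^sub>j = (\<surd>(2d) / n) \<langle>T\<^sub>j, W\<^sub>j\<rangle>\<close>, whose conditional variance is \<open>2 |T\<^sub>j|\<^sup>2 / n\<^sup>2\<close>. Since
  \<open>|T\<^sub>j|\<^sup>2\<close> has mean \<open>j\<close> and variance at most \<open>2 j\<^sup>2 / d\<close>, replacing the conditional variances by the
  constants \<open>2 j / n\<^sup>2\<close> costs only \<open>O(1 / \<surd>d)\<close> in total, and the Taylor remainders cost \<open>O(1 / \<surd>n)\<close>.
  So the characteristic function can be compared with \<open>exp (- t\<^sup>2 / 2)\<close> one factor at a time, and
  Levy's continuity theorem applies.

  The moments of the uniform distribution on the sphere follow from its invariance under sign changes
  of a coordinate and under the reflection \<open>(x, y) \<mapsto> ((x + y) / \<surd>2, (x - y) / \<surd>2)\<close> in a coordinate plane,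
  which forces \<open>E u\<^sub>a\<^sup>4 = 3 E u\<^sub>a\<^sup>2 u\<^sub>b\<^sup>2\<close>.
\<close>

section \<open>Bounded measurable functions\<close>

text \<open>Coordinates of unit vectors are bounded, so the integrands of the moment computations
  lie in this class. Its closure under algebraic operations reduces integrability side conditions to
  structural rules.\<close>

definition bounded_measurable ::
    "'a measure \<Rightarrow> ('a \<Rightarrow> 'b::{real_normed_field, banach, second_countable_topology}) \<Rightarrow> bool" where
  "bounded_measurable M f \<longleftrightarrow>
     f \<in> borel_measurable M \<and> (\<exists>B. \<forall>x\<in>space M. norm (f x) \<le> B)"

lemma bounded_measurableI:
  "f \<in> borel_measurable M \<Longrightarrow> (\<And>x. x \<in> space M \<Longrightarrow> norm (f x) \<le> B) \<Longrightarrow> bounded_measurable M f"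
  unfolding bounded_measurable_def by auto

lemma bounded_measurable_const: "bounded_measurable M (\<lambda>_. c)"
  by (rule bounded_measurableI[of _ _ "norm c"]) auto

lemma bounded_measurable_add:
  assumes "bounded_measurable M f" "bounded_measurable M g"
  shows "bounded_measurable M (\<lambda>x. f x + g x)"
proof -
  from assms obtain A B where "\<And>x. x \<in> space M \<Longrightarrow> norm (f x) \<le> A" "\<And>x. x \<in> space M \<Longrightarrow> norm (g x) \<le> B"
    unfolding bounded_measurable_def by auto
  then show ?thesis using assms
    by (intro bounded_measurableI[of _ _ "A + B"])
       (auto simp: bounded_measurable_def intro: order_trans[OF norm_triangle_ineq] add_mono)
qed

lemma bounded_measurable_mult:
  assumes "bounded_measurable M f" "bounded_measurable M g"
  shows "bounded_measurable M (\<lambda>x. f x * g x)"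
proof -
  from assms obtain A B where *: "\<And>x. x \<in> space M \<Longrightarrow> norm (f x) \<le> A" "\<And>x. x \<in> space M \<Longrightarrow> norm (g x) \<le> B"
    unfolding bounded_measurable_def by auto
  have "norm (f x * g x) \<le> A * B" if "x \<in> space M" for x
    using *[OF that] by (auto simp: norm_mult intro!: mult_mono order_trans[OF norm_ge_zero])
  then show ?thesis using assms
    by (intro bounded_measurableI[of _ _ "A * B"]) (auto simp: bounded_measurable_def)
qed

lemma bounded_measurable_diff:
  assumes "bounded_measurable M f" "bounded_measurable M g"
  shows "bounded_measurable M (\<lambda>x. f x - g x)"
  using bounded_measurable_add[OF assms(1) bounded_measurable_mult[OF bounded_measurable_const[of M "- 1"] assms(2)]]
  by simp

lemma bounded_measurable_minus:
  "bounded_measurable M f \<Longrightarrow> bounded_measurable M (\<lambda>x. - f x)"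
  using bounded_measurable_diff[OF bounded_measurable_const[of M 0]] by simp

lemma bounded_measurable_divide:
  "bounded_measurable M f \<Longrightarrow> bounded_measurable M (\<lambda>x. f x / c)"
  unfolding divide_inverse by (intro bounded_measurable_mult bounded_measurable_const)

lemma bounded_measurable_power:
  "bounded_measurable M f \<Longrightarrow> bounded_measurable M (\<lambda>x. f x ^ n)"
  by (induction n) (auto intro: bounded_measurable_const bounded_measurable_mult)

lemma bounded_measurable_sum:
  "(\<And>i. i \<in> I \<Longrightarrow> bounded_measurable M (f i)) \<Longrightarrow> bounded_measurable M (\<lambda>x. \<Sum>i\<in>I. f i x)"
  by (induction I rule: infinite_finite_induct) (auto intro: bounded_measurable_const bounded_measurable_add)

lemma bounded_measurable_abs:
  "bounded_measurable M f \<Longrightarrow> bounded_measurable M (\<lambda>x. \<bar>f x :: real\<bar>)"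
  unfolding bounded_measurable_def by auto

lemma bounded_measurable_iexp:
  "bounded_measurable M f \<Longrightarrow> bounded_measurable M (\<lambda>x. iexp (f x))"
  unfolding bounded_measurable_def by auto

lemma bounded_measurable_of_real:
  "bounded_measurable M f \<Longrightarrow> bounded_measurable M (\<lambda>x. complex_of_real (f x))"
  unfolding bounded_measurable_def by auto

lemmas bounded_measurable_intros =
  bounded_measurable_const bounded_measurable_add bounded_measurable_mult bounded_measurable_diff
  bounded_measurable_minus bounded_measurable_divide bounded_measurable_power bounded_measurable_sum
  bounded_measurable_abs bounded_measurable_iexp bounded_measurable_of_real

lemma bounded_measurable_compose:
  assumes "bounded_measurable N f" "g \<in> measurable M N"
  shows "bounded_measurable M (\<lambda>x. f (g x))"
  using assms measurable_space[OF assms(2)] unfolding bounded_measurable_def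
  by (auto intro: measurable_compose[rotated])

lemma (in finite_measure) integrable_bounded_measurable:
  "bounded_measurable M f \<Longrightarrow> integrable M f"
  unfolding bounded_measurable_def by (auto intro: integrable_const_bound)

section \<open>Isotropic random vectors\<close>

text \<open>This isolates what the limit argument uses of the random unit vector W with coordinates
  \<open>h k\<close>. The norm is 1 only almost everywhere because \<open>direction\<close> sends
  the origin to 0. Keeping \<open>C\<close> as a parameter lets the constants multiply under tensor
  products.\<close>

locale isotropic = prob_space \<nu> for \<nu> :: "'b measure" +
  fixes K :: "'k set" and h :: "'k \<Rightarrow> 'b \<Rightarrow> real" and C :: real
  assumes finite_K: "finite K" and K_nonempty: "K \<noteq> {}" and C_nonneg: "0 \<le> C"
    and h_measurable: "k \<in> K \<Longrightarrow> h k \<in> borel_measurable \<nu>"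
    and h_bounded: "k \<in> K \<Longrightarrow> x \<in> space \<nu> \<Longrightarrow> \<bar>h k x\<bar> \<le> 1"
    and h_norm: "AE x in \<nu>. (\<Sum>k\<in>K. (h k x)\<^sup>2) = 1"
    and moment1: "(\<integral>x. (\<Sum>k\<in>K. T k * h k x) \<partial>\<nu>) = 0"
    and moment2: "(\<integral>x. (\<Sum>k\<in>K. T k * h k x)\<^sup>2 \<partial>\<nu>) = (\<Sum>k\<in>K. (T k)\<^sup>2) / real (card K)"
    and moment4: "(\<integral>x. (\<Sum>k\<in>K. T k * h k x) ^ 4 \<partial>\<nu>) \<le> C * (\<Sum>k\<in>K. (T k)\<^sup>2)\<^sup>2 / (real (card K))\<^sup>2"
begin

abbreviation d :: real where "d \<equiv> real (card K)"

lemma d_pos: "0 < d"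
  using finite_K K_nonempty by (simp add: card_gt_0_iff)

lemma h_bounded_measurable: "k \<in> K \<Longrightarrow> bounded_measurable \<nu> (h k)"
  using h_measurable h_bounded by (intro bounded_measurableI[of _ _ 1]) auto

definition form :: "('k \<Rightarrow> real) \<Rightarrow> 'b \<Rightarrow> real" where
  "form T y = (\<Sum>k\<in>K. T k * h k y)"

lemma form_bounded_measurable [intro]: "bounded_measurable \<nu> (form T)"
  unfolding form_def[abs_def] by (intro bounded_measurable_intros h_bounded_measurable)

section \<open>Partial sums and the U-statistic on the product space\<close>

definition Prod :: "nat \<Rightarrow> (nat \<Rightarrow> 'b) measure" where
  "Prod j = PiM {..<j} (\<lambda>_. \<nu>)"

definition walk :: "nat \<Rightarrow> (nat \<Rightarrow> 'b) \<Rightarrow> 'k \<Rightarrow> real" where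
  "walk j x k = (\<Sum>i<j. h k (x i))"

definition walk_sq :: "nat \<Rightarrow> (nat \<Rightarrow> 'b) \<Rightarrow> real" where
  "walk_sq j x = (\<Sum>k\<in>K. (walk j x k)\<^sup>2)"

text \<open>Expanding \<open>walk\<close> gives the sum of <W_i, W_m> over i < m < j, a degenerate
  U-statistic. Grouping by the larger index exhibits the martingale differences.\<close>

definition ustat :: "nat \<Rightarrow> (nat \<Rightarrow> 'b) \<Rightarrow> real" where
  "ustat j x = (\<Sum>m<j. form (walk m x) (x m))"

lemma prob_space_Prod: "prob_space (Prod j)"
  unfolding Prod_def by (rule prob_space_PiM) unfold_locales

text \<open>Only coordinates below \<open>m\<close> enter. This adaptedness, shared by the next two
  facts, allows coordinate \<open>j\<close> to be integrated out with the past frozen.\<close>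

lemma walk_update [simp]: "m \<le> j \<Longrightarrow> walk m (x(j := y)) = walk m x"
  unfolding walk_def by (intro ext sum.cong) auto

lemma walk_sq_update [simp]: "m \<le> j \<Longrightarrow> walk_sq m (x(j := y)) = walk_sq m x"
  unfolding walk_sq_def by simp

lemma ustat_update [simp]: "m \<le> j \<Longrightarrow> ustat m (x(j := y)) = ustat m x"
  unfolding ustat_def by (intro sum.cong) auto

lemma ustat_Suc: "ustat (Suc j) x = ustat j x + form (walk j x) (x j)"
  by (simp add: ustat_def)

text \<open>The last sum is kept unevaluated, since it equals 1 only almost everywhere.\<close>

lemma walk_sq_Suc:
  "walk_sq (Suc j) x = walk_sq j x + 2 * form (walk j x) (x j) + (\<Sum>k\<in>K. (h k (x j))\<^sup>2)"
  unfolding walk_sq_def form_def walk_def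
  by (simp add: power2_sum sum.distrib sum_distrib_left mult_ac)

lemma h_coord_bounded_measurable [intro]:
  "k \<in> K \<Longrightarrow> i < j \<Longrightarrow> bounded_measurable (Prod j) (\<lambda>x. h k (x i))"
  by (rule bounded_measurable_compose[OF h_bounded_measurable]) (auto simp: Prod_def)

lemma walk_bounded_measurable [intro]:
  "k \<in> K \<Longrightarrow> m \<le> j \<Longrightarrow> bounded_measurable (Prod j) (\<lambda>x. walk m x k)"
  unfolding walk_def[abs_def] by (intro bounded_measurable_intros h_coord_bounded_measurable) auto

lemma walk_sq_bounded_measurable [intro]:
  "m \<le> j \<Longrightarrow> bounded_measurable (Prod j) (walk_sq m)"
  unfolding walk_sq_def[abs_def] by (intro bounded_measurable_intros walk_bounded_measurable)

lemma ustat_bounded_measurable [intro]: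
  "m \<le> j \<Longrightarrow> bounded_measurable (Prod j) (ustat m)"
  unfolding ustat_def[abs_def] form_def
  by (intro bounded_measurable_intros walk_bounded_measurable h_coord_bounded_measurable) auto

lemmas bounded_measurable_rules = bounded_measurable_intros form_bounded_measurable walk_sq_bounded_measurable
  ustat_bounded_measurable

text \<open>Fubini in the last coordinate: the inner integral plays the role of the conditional
  expectation given the first \<open>j\<close> observations.\<close>

lemma integral_Prod_Suc:
  fixes f :: "(nat \<Rightarrow> 'b) \<Rightarrow> 'c::{real_normed_field, banach, second_countable_topology}"
  assumes "bounded_measurable (Prod (Suc j)) f"
  shows "(\<integral>x. f x \<partial>Prod (Suc j)) = (\<integral>x. (\<integral>y. f (x(j := y)) \<partial>\<nu>) \<partial>Prod j)"
proof -
  interpret product_sigma_finite "\<lambda>_::nat. \<nu>" by unfold_locales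
  interpret S: prob_space "Prod (Suc j)" by (rule prob_space_Prod)
  have "integrable (PiM (insert j {..<j}) (\<lambda>_. \<nu>)) f"
    using S.integrable_bounded_measurable[OF assms] by (simp add: Prod_def lessThan_Suc)
  from product_integral_insert[OF _ _ this] show ?thesis
    by (simp add: Prod_def lessThan_Suc)
qed

lemma integrable_Prod: "bounded_measurable (Prod j) f \<Longrightarrow> integrable (Prod j) f"
  using prob_space_Prod[of j]
  by (intro finite_measure.integrable_bounded_measurable prob_space.finite_measure)

section \<open>Moments of the squared length of the partial sums\<close>

lemma form_moments:
  "(\<integral>y. form T y \<partial>\<nu>) = 0" "(\<integral>y. (form T y)\<^sup>2 \<partial>\<nu>) = (\<Sum>k\<in>K. (T k)\<^sup>2) / d"
  "(\<integral>y. form T y ^ 4 \<partial>\<nu>) \<le> C * (\<Sum>k\<in>K. (T k)\<^sup>2)\<^sup>2 / d\<^sup>2"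
  using moment1 moment2 moment4 by (simp_all add: form_def)

lemma measure_space_Prod [simp]: "measure (Prod j) (space (Prod j)) = 1"
  by (rule prob_space.prob_space[OF prob_space_Prod])

text \<open>Given the past, the cross term has mean zero and the new unit vector contributes
  1.\<close>

lemma walk_sq_mean: "(\<integral>x. walk_sq j x \<partial>Prod j) = j"
proof (induction j)
  case (Suc j)
  have "(\<integral>x. walk_sq (Suc j) x \<partial>Prod (Suc j)) = (\<integral>x. (\<integral>y. walk_sq (Suc j) (x(j := y)) \<partial>\<nu>) \<partial>Prod j)"
    by (intro integral_Prod_Suc bounded_measurable_rules) auto
  also have "\<dots> = (\<integral>x. walk_sq j x + 1 \<partial>Prod j)"
  proof (intro Bochner_Integration.integral_cong refl)
    fix x
    have "(\<integral>y. walk_sq (Suc j) (x(j := y)) \<partial>\<nu>) = (\<integral>y. walk_sq j x + 2 * form (walk j x) y + 1 \<partial>\<nu>)"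
      using h_norm by (intro integral_cong_AE)
        (auto simp: walk_sq_Suc h_measurable form_def intro!: borel_measurable_add borel_measurable_sum
           borel_measurable_times borel_measurable_power)
    also have "\<dots> = walk_sq j x + 1"
      by (simp add: integrable_bounded_measurable bounded_measurable_rules form_moments prob_space)
    finally show "(\<integral>y. walk_sq (Suc j) (x(j := y)) \<partial>\<nu>) = walk_sq j x + 1" .
  qed
  also have "\<dots> = Suc j"
    by (simp add: integrable_Prod bounded_measurable_rules Suc)
  finally show ?case .
qed (simp add: walk_sq_def walk_def)

text \<open>The centred squared length moves by 2 <T_j, W_j>, a martingale difference with
  conditional second moment 4 |T_j|^2 / d. By \<open>walk_sq_mean\<close> the variance therefore
  grows by 4 j / d in each step.\<close>

lemma walk_sq_variance: "(\<integral>x. (walk_sq j x - j)\<^sup>2 \<partial>Prod j) = 2 * j * (real j - 1) / d"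
proof (induction j)
  case (Suc j)
  have "(\<integral>x. (walk_sq (Suc j) x - Suc j)\<^sup>2 \<partial>Prod (Suc j)) =
      (\<integral>x. (\<integral>y. (walk_sq (Suc j) (x(j := y)) - Suc j)\<^sup>2 \<partial>\<nu>) \<partial>Prod j)"
    by (intro integral_Prod_Suc bounded_measurable_rules) auto
  also have "\<dots> = (\<integral>x. (walk_sq j x - j)\<^sup>2 + 4 * (walk_sq j x / d) \<partial>Prod j)"
  proof (intro Bochner_Integration.integral_cong refl)
    fix x
    have "(\<integral>y. (walk_sq (Suc j) (x(j := y)) - Suc j)\<^sup>2 \<partial>\<nu>) =
        (\<integral>y. (walk_sq j x - j)\<^sup>2 + 4 * (walk_sq j x - j) * form (walk j x) y + 4 * (form (walk j x) y)\<^sup>2 \<partial>\<nu>)"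
      using h_norm by (intro integral_cong_AE)
        (auto simp: walk_sq_Suc h_measurable form_def power2_eq_square algebra_simps
          intro!: borel_measurable_add borel_measurable_sum borel_measurable_diff
           borel_measurable_times borel_measurable_power)
    also have "\<dots> = (walk_sq j x - j)\<^sup>2 + 4 * (walk_sq j x / d)"
      by (simp add: integrable_bounded_measurable bounded_measurable_rules form_moments prob_space walk_sq_def)
    finally show "(\<integral>y. (walk_sq (Suc j) (x(j := y)) - Suc j)\<^sup>2 \<partial>\<nu>) = (walk_sq j x - j)\<^sup>2 + 4 * (walk_sq j x / d)" .
  qed
  also have "\<dots> = 2 * j * (real j - 1) / d + 4 * (j / d)"
    by (subst Bochner_Integration.integral_add) (simp_all add: integrable_Prod bounded_measurable_rules Suc walk_sq_mean)
  also have "\<dots> = 2 * real (Suc j) * (real (Suc j) - 1) / d"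
    using d_pos by (simp add: field_simps)
  finally show ?case .
qed (simp add: walk_sq_def walk_def)

lemma walk_sq_variance_le: "(\<integral>x. (walk_sq j x - j)\<^sup>2 \<partial>Prod j) \<le> 2 * (real j)\<^sup>2 / d"
  unfolding walk_sq_variance using d_pos
  by (intro divide_right_mono) (auto simp: power2_eq_square algebra_simps)

text \<open>This is variance plus squared mean; d >= 1 makes the constant 3 independent of the
  dimension.\<close>

lemma walk_sq_second_moment_le: "(\<integral>x. (walk_sq j x)\<^sup>2 \<partial>Prod j) \<le> 3 * (real j)\<^sup>2"
proof -
  have "(\<integral>x. (walk_sq j x)\<^sup>2 \<partial>Prod j) =
      (\<integral>x. (walk_sq j x - j)\<^sup>2 + (2 * j * walk_sq j x - (real j)\<^sup>2) \<partial>Prod j)"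
    by (intro Bochner_Integration.integral_cong) (auto simp: power2_eq_square algebra_simps)
  also have "\<dots> = (\<integral>x. (walk_sq j x - j)\<^sup>2 \<partial>Prod j) + (2 * j * j - (real j)\<^sup>2)"
    by (simp add: integrable_Prod bounded_measurable_rules walk_sq_mean)
  also have "\<dots> \<le> 2 * (real j)\<^sup>2 / d + (real j)\<^sup>2"
    using walk_sq_variance_le[of j] by (simp add: power2_eq_square)
  also have "2 * (real j)\<^sup>2 / d \<le> 2 * (real j)\<^sup>2 / 1"
    using d_pos by (intro divide_left_mono) auto
  finally show ?thesis by simp
qed

section \<open>Comparison of characteristic functions\<close>

text \<open>With \<open>T\<close> a frozen value of the walk, the integral is the conditional
  characteristic function of a scaled increment. A second-order expansion gives 1 - t^2 s / n^2, to
  be compared with 1 - t^2 j / n^2. The three error terms come from s versus j, from linearising the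
  exponential, and from the Taylor remainder.\<close>

lemma char_increment_le:
  fixes T :: "'k \<Rightarrow> real" and t :: real and n j :: nat
  assumes "0 < n" "j \<le> n"
  defines "s \<equiv> \<Sum>k\<in>K. (T k)\<^sup>2"
  shows "cmod ((\<integral>y. iexp (t * (sqrt (2 * d) / n * form T y)) \<partial>\<nu>) - complex_of_real (exp (- (t\<^sup>2 * j / n\<^sup>2))))
    \<le> t\<^sup>2 / (real n)\<^sup>2 * \<bar>s - j\<bar> + t ^ 4 / (2 * (real n)\<^sup>2)
      + \<bar>t\<bar> ^ 3 / 6 * (s / ((real n)\<^sup>2 * sqrt n) + 2 * C * sqrt n * s\<^sup>2 / real n ^ 4)"
proof -
  define D where "D y = sqrt (2 * d) / n * form T y" for y
  have bmD: "bounded_measurable \<nu> D"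
    unfolding D_def[abs_def] by (intro bounded_measurable_rules)
  have D1: "(\<integral>y. D y \<partial>\<nu>) = 0"
    by (simp add: D_def form_moments)
  \<comment> \<open>The factor 2 d from the scaling cancels the 1 / d of the covariance; in the
    fourth moment (2 d)^2 cancels 1 / d^2 in the same way.\<close>
  have "(\<integral>y. (D y)\<^sup>2 \<partial>\<nu>) = (2 * d) / (real n)\<^sup>2 * (\<integral>y. (form T y)\<^sup>2 \<partial>\<nu>)"
    by (simp add: D_def power_mult_distrib power_divide)
  then have D2: "(\<integral>y. (D y)\<^sup>2 \<partial>\<nu>) = 2 * s / (real n)\<^sup>2"
    using d_pos by (simp add: form_moments s_def)
  have "sqrt (2 * d) ^ 4 = (2 * d)\<^sup>2"
    using d_pos by (simp add: power4_eq_xxxx power2_eq_square)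
  then have "(\<integral>y. D y ^ 4 \<partial>\<nu>) = (2 * d)\<^sup>2 / real n ^ 4 * (\<integral>y. form T y ^ 4 \<partial>\<nu>)"
    by (simp add: D_def power_mult_distrib power_divide)
  also have "\<dots> \<le> (2 * d)\<^sup>2 / real n ^ 4 * (C * s\<^sup>2 / d\<^sup>2)"
    unfolding s_def by (intro mult_left_mono form_moments) auto
  also have "\<dots> = 4 * C * s\<^sup>2 / real n ^ 4"
    using d_pos by (simp add: power_mult_distrib)
  finally have D4: "(\<integral>y. D y ^ 4 \<partial>\<nu>) \<le> 4 * C * s\<^sup>2 / real n ^ 4" .
  \<comment> \<open>For s of order n, \<open>D\<close> has size about n^(-1/2), so the weight sqrt n
    makes D^2 / r and r D^4 both of order n^(-3/2).\<close>
  define r where "r = sqrt n"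
  have r: "r > 0" using assms by (simp add: r_def)
  \<comment> \<open>AM-GM bounds the third absolute moment by the second and the fourth.\<close>
  have cube: "\<bar>D y\<bar> ^ 3 \<le> ((D y)\<^sup>2 / r + r * D y ^ 4) / 2" for y
  proof -
    have "0 \<le> (D y)\<^sup>2 * (1 - r * \<bar>D y\<bar>)\<^sup>2 / (2 * r)"
      using r by simp
    also have "(D y)\<^sup>2 * (1 - r * \<bar>D y\<bar>)\<^sup>2 = (D y)\<^sup>2 - 2 * r * \<bar>D y\<bar> ^ 3 + r\<^sup>2 * D y ^ 4"
      unfolding power2_abs[symmetric, of "D y"] power_even_abs_numeral[symmetric, of "num.Bit0 (num.Bit0 num.One)" "D y"]
      by (simp add: power2_eq_square power3_eq_cube power4_eq_xxxx algebra_simps)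
    finally show ?thesis
      using r by (simp add: field_simps power2_eq_square)
  qed
  have "(\<integral>y. \<bar>D y\<bar> ^ 3 \<partial>\<nu>) \<le> (\<integral>y. ((D y)\<^sup>2 / r + r * D y ^ 4) / 2 \<partial>\<nu>)"
    by (intro integral_mono integrable_bounded_measurable bounded_measurable_rules bmD cube)
  also have "\<dots> = ((\<integral>y. (D y)\<^sup>2 \<partial>\<nu>) / r + r * (\<integral>y. D y ^ 4 \<partial>\<nu>)) / 2"
    by (simp add: integrable_bounded_measurable bounded_measurable_rules bmD)
  also have "\<dots> \<le> ((2 * s / (real n)\<^sup>2) / r + r * (4 * C * s\<^sup>2 / real n ^ 4)) / 2"
    unfolding D2 using r by (intro divide_right_mono add_mono mult_left_mono D4) auto
  also have "\<dots> = s / ((real n)\<^sup>2 * r) + 2 * C * r * s\<^sup>2 / real n ^ 4"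
    by (simp add: field_simps)
  finally have D3: "(\<integral>y. \<bar>D y\<bar> ^ 3 \<partial>\<nu>) \<le> s / ((real n)\<^sup>2 * r) + 2 * C * r * s\<^sup>2 / real n ^ 4" .

  \<comment> \<open>Integration removes the linear Taylor term and turns the quadratic one into t^2
    s / n^2, so \<open>?J\<close> is the integrated remainder.\<close>
  have "(\<integral>y. iexp (t * D y) - (1 + \<i> * (t * D y) - complex_of_real (t\<^sup>2 / 2 * (D y)\<^sup>2)) \<partial>\<nu>)
      = (\<integral>y. iexp (t * D y) \<partial>\<nu>) - (1 - complex_of_real (t\<^sup>2 / 2 * (2 * s / (real n)\<^sup>2)))"
    (is "?I = ?J")
  proof -
    have "?I = (\<integral>y. iexp (t * D y) \<partial>\<nu>)
        - ((1 + \<i> * complex_of_real t * complex_of_real (\<integral>y. D y \<partial>\<nu>))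
          - complex_of_real (t\<^sup>2 / 2 * (\<integral>y. (D y)\<^sup>2 \<partial>\<nu>)))"
    proof -
      have 1: "?I = (\<integral>y. iexp (t * D y) \<partial>\<nu>)
          - (\<integral>y. (1 + \<i> * (t * D y)) - complex_of_real (t\<^sup>2 / 2 * (D y)\<^sup>2) \<partial>\<nu>)"
        by (intro Bochner_Integration.integral_diff integrable_bounded_measurable bounded_measurable_rules bmD)
      have 2: "(\<integral>y. (1 + \<i> * (t * D y)) - complex_of_real (t\<^sup>2 / 2 * (D y)\<^sup>2) \<partial>\<nu>)
          = (\<integral>y. 1 + \<i> * (t * D y) \<partial>\<nu>) - (\<integral>y. complex_of_real (t\<^sup>2 / 2 * (D y)\<^sup>2) \<partial>\<nu>)"
        by (intro Bochner_Integration.integral_diff integrable_bounded_measurable bounded_measurable_rules bmD)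
      have 3: "(\<integral>y. 1 + \<i> * (t * D y) \<partial>\<nu>) = (\<integral>y. 1 \<partial>\<nu>) + (\<integral>y. \<i> * (t * D y) \<partial>\<nu>)"
        by (intro Bochner_Integration.integral_add integrable_bounded_measurable bounded_measurable_rules bmD)
      show ?thesis
        unfolding 1 2 3 integral_complex_of_real by (simp add: prob_space)
    qed
    then show ?thesis by (simp only: D1 D2) simp
  qed
  then have "cmod ?J = cmod ?I" by simp
  also have "\<dots> \<le> (\<integral>y. \<bar>t\<bar> ^ 3 / 6 * \<bar>D y\<bar> ^ 3 \<partial>\<nu>)"
  proof (rule order_trans[OF integral_norm_bound], intro integral_mono' integrable_bounded_measurable bounded_measurable_rules bmD)
    fix y
    show "cmod (iexp (t * D y) - (1 + \<i> * (t * D y) - complex_of_real (t\<^sup>2 / 2 * (D y)\<^sup>2)))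
        \<le> \<bar>t\<bar> ^ 3 / 6 * \<bar>D y\<bar> ^ 3"
      using iexp_approx1[of "t * D y" 2]
      by (simp add: numeral_2_eq_2 numeral_3_eq_3 abs_mult power_mult_distrib algebra_simps fact_numeral)
  qed simp
  also have "\<dots> = \<bar>t\<bar> ^ 3 / 6 * (\<integral>y. \<bar>D y\<bar> ^ 3 \<partial>\<nu>)"
    by simp
  also have "\<dots> \<le> \<bar>t\<bar> ^ 3 / 6 * (s / ((real n)\<^sup>2 * r) + 2 * C * r * s\<^sup>2 / real n ^ 4)"
    by (intro mult_left_mono D3) auto
  finally have A: "cmod ?J \<le> \<dots>" .

  define z where "z = t\<^sup>2 * j / (real n)\<^sup>2"
  have z: "0 \<le> z" by (simp add: z_def)
  \<comment> \<open>The upper bound for e^(-z) inverts e^z >= 1 + z + z^2/2 and uses (1 - z +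
    z^2/2)(1 + z + z^2/2) = 1 + z^4/4. The lower bound is e^(-z) >= 1 - z.\<close>
  have "exp (- z) \<le> 1 / (1 + z + z\<^sup>2 / 2)"
    using exp_lower_Taylor_quadratic[OF z] z
    by (simp add: exp_minus inverse_eq_divide divide_left_mono add_pos_nonneg)
  also have "\<dots> \<le> 1 - z + z\<^sup>2 / 2"
  proof -
    have "(1 - z + z\<^sup>2 / 2) * (1 + z + z\<^sup>2 / 2) = 1 + z ^ 4 / 4"
      by (simp add: field_simps power2_eq_square power4_eq_xxxx)
    then have "1 \<le> (1 - z + z\<^sup>2 / 2) * (1 + z + z\<^sup>2 / 2)" by simp
    then show ?thesis using z by (subst pos_divide_le_eq) (auto intro: add_pos_nonneg)
  qed
  finally have "\<bar>exp (- z) - (1 - z)\<bar> \<le> z\<^sup>2 / 2"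
    using exp_ge_add_one_self[of "- z"] by (simp add: abs_le_iff)
  \<comment> \<open>From j <= n follows z <= t^2 / n, a bound uniform in \<open>j\<close>.\<close>
  also have "z \<le> t\<^sup>2 * n / (real n)\<^sup>2"
    unfolding z_def using assms by (intro divide_right_mono mult_left_mono) auto
  then have "z\<^sup>2 / 2 \<le> (t\<^sup>2 * n / (real n)\<^sup>2)\<^sup>2 / 2"
    using z by (intro divide_right_mono power_mono) auto
  also have "\<dots> = t ^ 4 / (2 * (real n)\<^sup>2)"
    using assms by (simp add: field_simps power2_eq_square power4_eq_xxxx)
  finally have B: "\<bar>exp (- z) - (1 - z)\<bar> \<le> t ^ 4 / (2 * (real n)\<^sup>2)" .

  have "(\<integral>y. iexp (t * D y) \<partial>\<nu>) - complex_of_real (exp (- z)) =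
      ?J + complex_of_real (- (t\<^sup>2 / (real n)\<^sup>2 * (s - j))) - complex_of_real (exp (- z) - (1 - z))"
    unfolding z_def by (simp add: algebra_simps diff_divide_distrib)
  also have "cmod \<dots> \<le> cmod ?J + \<bar>t\<^sup>2 / (real n)\<^sup>2 * (s - j)\<bar> + \<bar>exp (- z) - (1 - z)\<bar>"
    by (rule order_trans[OF norm_triangle_ineq4], rule add_mono,
        rule order_trans[OF norm_triangle_ineq]) (simp_all only: norm_of_real abs_minus_cancel order_refl)
  also have "\<dots> \<le> \<bar>t\<bar> ^ 3 / 6 * (s / ((real n)\<^sup>2 * r) + 2 * C * r * s\<^sup>2 / real n ^ 4)
      + t\<^sup>2 / (real n)\<^sup>2 * \<bar>s - j\<bar> + t ^ 4 / (2 * (real n)\<^sup>2)"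
    using A B by (intro add_mono) (auto simp: abs_mult)
  finally show ?thesis
    by (simp add: D_def r_def z_def algebra_simps)
qed

text \<open>The normalisation stays that of sample size \<open>n\<close> while \<open>j\<close>
  counts the observations used so far, so consecutive values differ by one martingale
  difference.\<close>

definition cf :: "nat \<Rightarrow> real \<Rightarrow> nat \<Rightarrow> complex" where
  "cf n t j = (\<integral>x. iexp (t * (sqrt (2 * d) / n * ustat j x)) \<partial>Prod j)"

text \<open>The exponential of \<open>ustat j\<close> depends only on the past and has modulus 1.
  Pulled out of the inner integral, it leaves the bound of \<open>char_increment_le\<close>,
  averaged over the walk. The factor 1 / n lets n such errors be added.\<close>

lemma cf_step_le:
  assumes "0 < n" "j \<le> n"
  shows "cmod (cf n t (Suc j) - complex_of_real (exp (- (t\<^sup>2 * j / n\<^sup>2))) * cf n t j)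
    \<le> (3 / 2 * t\<^sup>2 / sqrt d + t ^ 4 / (2 * real n) + \<bar>t\<bar> ^ 3 * (1 + 6 * C) / (6 * sqrt n)) / n"
proof -
  define c where "c = sqrt (2 * d) / n"
  define e :: complex where "e = complex_of_real (exp (- (t\<^sup>2 * j / n\<^sup>2)))"
  \<comment> \<open>\<open>R\<close> replaces |s - j| by its AM-GM majorant with weight n / sqrt d,
    the order of the standard deviation of \<open>walk_sq j\<close>. Its integral then involves only
    the mean, variance and second moment of \<open>walk_sq j\<close>.\<close>
  define R where "R x = t\<^sup>2 / (real n)\<^sup>2 * ((n / sqrt d + (walk_sq j x - j)\<^sup>2 * sqrt d / n) / 2) + t ^ 4 / (2 * (real n)\<^sup>2)
      + \<bar>t\<bar> ^ 3 / 6 * (walk_sq j x / ((real n)\<^sup>2 * sqrt n) + 2 * C * sqrt n * (walk_sq j x)\<^sup>2 / real n ^ 4)" for x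
  let ?f = "\<lambda>x. iexp (t * (c * ustat (Suc j) x)) - e * iexp (t * (c * ustat j x))"
  have "cf n t (Suc j) - e * cf n t j = (\<integral>x. ?f x \<partial>Prod (Suc j))"
  proof -
    \<comment> \<open>Since \<open>ustat j\<close> ignores coordinate \<open>j\<close>, both terms
      can be written over \<open>Prod (Suc j)\<close>.\<close>
    have "(\<integral>x. iexp (t * (c * ustat j x)) \<partial>Prod (Suc j)) = cf n t j"
      by (subst integral_Prod_Suc, intro bounded_measurable_rules) (auto simp: cf_def c_def prob_space)
    moreover have integrable_iexp: "integrable (Prod (Suc j)) (\<lambda>x. iexp (t * (c * ustat m x)))"
      if "m \<le> Suc j" for m
      by (intro integrable_Prod bounded_measurable_rules that)
    have "(\<integral>x. ?f x \<partial>Prod (Suc j)) = (\<integral>x. iexp (t * (c * ustat (Suc j) x)) \<partial>Prod (Suc j))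
        - e * (\<integral>x. iexp (t * (c * ustat j x)) \<partial>Prod (Suc j))"
      using integrable_iexp[of "Suc j"] integrable_iexp[of j]
      by (subst Bochner_Integration.integral_diff) auto
    ultimately show ?thesis by (simp add: cf_def c_def)
  qed
  also have "\<dots> = (\<integral>x. (\<integral>y. ?f (x(j := y)) \<partial>\<nu>) \<partial>Prod j)"
    by (intro integral_Prod_Suc bounded_measurable_rules) auto
  also have "\<dots> = (\<integral>x. iexp (t * (c * ustat j x)) * ((\<integral>y. iexp (t * (c * form (walk j x) y)) \<partial>\<nu>) - e) \<partial>Prod j)"
  proof (intro Bochner_Integration.integral_cong refl)
    fix x
    have "?f (x(j := y)) = iexp (t * (c * ustat j x)) * (iexp (t * (c * form (walk j x) y)) - e)" for y
      by (simp add: ustat_Suc ring_distribs exp_add)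
    then show "(\<integral>y. ?f (x(j := y)) \<partial>\<nu>) =
        iexp (t * (c * ustat j x)) * ((\<integral>y. iexp (t * (c * form (walk j x) y)) \<partial>\<nu>) - e)"
      by (simp only: integral_mult_right_zero)
         (subst Bochner_Integration.integral_diff, intro integrable_bounded_measurable bounded_measurable_rules, simp_all add: prob_space)
  qed
  also have "cmod \<dots> \<le> (\<integral>x. R x \<partial>Prod j)"
  proof (rule order_trans[OF integral_norm_bound], rule integral_mono')
    show "integrable (Prod j) R"
      unfolding R_def[abs_def] by (intro integrable_Prod bounded_measurable_rules) auto
  next
    fix x
    have amgm: "\<bar>walk_sq j x - j\<bar> \<le> (n / sqrt d + (walk_sq j x - j)\<^sup>2 * sqrt d / n) / 2"
    proof -
      define b where "b = n / sqrt d"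
      have b: "b > 0" using d_pos assms by (simp add: b_def)
      have "0 \<le> (b - \<bar>walk_sq j x - j\<bar>)\<^sup>2 / (2 * b)" using b by simp
      also have "\<dots> = (b + (walk_sq j x - j)\<^sup>2 / b) / 2 - \<bar>walk_sq j x - j\<bar>"
        using b by (simp add: power2_eq_square field_simps)
      finally show ?thesis by (simp add: b_def)
    qed
    have "cmod (iexp (t * (c * ustat j x)) * ((\<integral>y. iexp (t * (c * form (walk j x) y)) \<partial>\<nu>) - e)) =
        cmod ((\<integral>y. iexp (t * (c * form (walk j x) y)) \<partial>\<nu>) - e)"
      by (simp add: norm_mult)
    also have "\<dots> \<le> t\<^sup>2 / (real n)\<^sup>2 * \<bar>walk_sq j x - j\<bar> + t ^ 4 / (2 * (real n)\<^sup>2)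
      + \<bar>t\<bar> ^ 3 / 6 * (walk_sq j x / ((real n)\<^sup>2 * sqrt n) + 2 * C * sqrt n * (walk_sq j x)\<^sup>2 / real n ^ 4)"
      using char_increment_le[OF assms, of t "walk j x"] by (simp add: c_def e_def walk_sq_def)
    also have "\<dots> \<le> R x"
      unfolding R_def by (intro add_mono order_refl mult_left_mono amgm) auto
    finally show *: "cmod (iexp (t * (c * ustat j x)) * ((\<integral>y. iexp (t * (c * form (walk j x) y)) \<partial>\<nu>) - e)) \<le> R x" .
    show "0 \<le> R x"
      using order_trans[OF norm_ge_zero *] .
  qed
  also have "(\<integral>x. R x \<partial>Prod j) = t\<^sup>2 / (real n)\<^sup>2 * ((n / sqrt d + (\<integral>x. (walk_sq j x - j)\<^sup>2 \<partial>Prod j) * sqrt d / n) / 2)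
      + t ^ 4 / (2 * (real n)\<^sup>2)
      + \<bar>t\<bar> ^ 3 / 6 * (j / ((real n)\<^sup>2 * sqrt n) + 2 * C * sqrt n * (\<integral>x. (walk_sq j x)\<^sup>2 \<partial>Prod j) / real n ^ 4)"
    unfolding R_def by (simp add: integrable_Prod bounded_measurable_rules walk_sq_mean)
  \<comment> \<open>Bounding \<open>j\<close> by \<open>n\<close> makes the error the same for every
    step.\<close>
  also have "\<dots> \<le> t\<^sup>2 / (real n)\<^sup>2 * ((n / sqrt d + (2 * (real n)\<^sup>2 / d) * sqrt d / n) / 2)
      + t ^ 4 / (2 * (real n)\<^sup>2)
      + \<bar>t\<bar> ^ 3 / 6 * (n / ((real n)\<^sup>2 * sqrt n) + 2 * C * sqrt n * (3 * (real n)\<^sup>2) / real n ^ 4)"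
  proof -
    have "(\<integral>x. (walk_sq j x - j)\<^sup>2 \<partial>Prod j) \<le> 2 * (real n)\<^sup>2 / d"
      using assms by (intro order_trans[OF walk_sq_variance_le] divide_right_mono) (auto intro: power_mono)
    moreover have "(\<integral>x. (walk_sq j x)\<^sup>2 \<partial>Prod j) \<le> 3 * (real n)\<^sup>2"
      using assms by (intro order_trans[OF walk_sq_second_moment_le]) (auto intro: power_mono)
    ultimately show ?thesis
      using assms C_nonneg d_pos
      by (intro add_mono mult_left_mono divide_right_mono mult_right_mono order_refl) auto
  qed
  also have "\<dots> = (3 / 2 * t\<^sup>2 / sqrt d + t ^ 4 / (2 * real n) + \<bar>t\<bar> ^ 3 * (1 + 6 * C) / (6 * sqrt n)) / n"
  proof -
    \<comment> \<open>Writing n = r^2 and d = q^2 turns the claim into a rational identity.\<close>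
    define r q where "r = sqrt n" and "q = sqrt d"
    have *: "real n = r * r" "d = q * q" "r > 0" "q > 0"
      using assms d_pos by (auto simp: r_def q_def)
    show ?thesis
      unfolding r_def[symmetric] q_def[symmetric] *(1,2) using *(3,4)
      by (simp add: field_simps power2_eq_square power4_eq_xxxx)
  qed
  finally show ?thesis by (simp only: e_def)
qed

text \<open>The Gaussian factors exp (- t^2 i / n^2) multiply up to the comparison term. Each has
  modulus at most 1, so errors already made are not amplified and the one-step errors simply
  add.\<close>

lemma cf_le:
  assumes "0 < n" "j \<le> n"
  shows "cmod (cf n t j - complex_of_real (exp (- (t\<^sup>2 * real (\<Sum>i<j. i) / n\<^sup>2))))
    \<le> j * ((3 / 2 * t\<^sup>2 / sqrt d + t ^ 4 / (2 * real n) + \<bar>t\<bar> ^ 3 * (1 + 6 * C) / (6 * sqrt n)) / n)"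
    (is "_ \<le> _ * ?E")
  using \<open>j \<le> n\<close>
proof (induction j)
  case (Suc j)
  define e where "e j = complex_of_real (exp (- (t\<^sup>2 * real j / n\<^sup>2)))" for j
  have "cf n t (Suc j) - e (\<Sum>i<Suc j. i) = (cf n t (Suc j) - e j * cf n t j) + e j * (cf n t j - e (\<Sum>i<j. i))"
    by (simp add: e_def ring_distribs add_divide_distrib mult_exp_exp flip: of_real_mult del: of_nat_sum)
  also have "cmod \<dots> \<le> ?E + cmod (e j) * cmod (cf n t j - e (\<Sum>i<j. i))"
    using cf_step_le[of n j t] assms Suc.prems
    by (intro order_trans[OF norm_triangle_ineq] add_mono) (auto simp: e_def norm_mult)
  also have "\<dots> \<le> ?E + 1 * (j * ?E)"
    using Suc by (intro add_mono mult_mono order_refl) (auto simp: e_def)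
  also have "\<dots> = Suc j * ?E"
    by (simp only: of_nat_Suc distrib_right mult_1_left)
  finally show ?case by (simp only: e_def of_nat_power)
qed (simp add: cf_def ustat_def)

text \<open>The constants 2 i / n^2 for i < n sum to 1 - 1 / n, the variance of the comparison
  Gaussian.\<close>

lemma cf_final_le:
  assumes "0 < n"
  shows "cmod (cf n t n - complex_of_real (exp (- (t\<^sup>2 / 2 * (1 - 1 / n)))))
    \<le> 3 / 2 * t\<^sup>2 / sqrt d + t ^ 4 / (2 * real n) + \<bar>t\<bar> ^ 3 * (1 + 6 * C) / (6 * sqrt n)"
proof -
  have "2 * (\<Sum>i<n. real i) = real n * (real n - 1)"
    by (induction n) (auto simp: algebra_simps)
  then have "real (\<Sum>i<n. i) = real n * (real n - 1) / 2" by simp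
  then have "t\<^sup>2 * real (\<Sum>i<n. i) / (real n)\<^sup>2 = t\<^sup>2 / 2 * (1 - 1 / n)"
    using assms by (simp only:) (simp add: field_simps power2_eq_square)
  with cf_le[OF assms order_refl, of t] show ?thesis using assms by (simp del: of_nat_sum)
qed

end

section \<open>Tensor products\<close>

context isotropic
begin

text \<open>Cauchy-Schwarz in AM-GM form reduces the mixed moment to two pure fourth moments. It
  serves the fourth moment of a bilinear form in \<open>isotropic_pair\<close>.\<close>

lemma form_mixed_moment_le:
  "(\<integral>y. (form S y)\<^sup>2 * (form T y)\<^sup>2 \<partial>\<nu>) \<le> C / d\<^sup>2 * ((\<Sum>k\<in>K. (S k)\<^sup>2) * (\<Sum>k\<in>K. (T k)\<^sup>2))"
proof -
  define s t where "s = (\<Sum>k\<in>K. (S k)\<^sup>2)" and "t = (\<Sum>k\<in>K. (T k)\<^sup>2)"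
  have nonneg: "0 \<le> s" "0 \<le> t"
    by (auto simp: s_def t_def intro: sum_nonneg)
  show ?thesis
  \<comment> \<open>The AM-GM weights divide by s and t; if one of them is 0, the corresponding form
    vanishes identically.\<close>
  proof (cases "s = 0 \<or> t = 0")
    case True
    then have "(\<forall>k\<in>K. S k = 0) \<or> (\<forall>k\<in>K. T k = 0)"
      using finite_K by (auto simp: s_def t_def sum_nonneg_eq_0_iff)
    then have "(form S y)\<^sup>2 * (form T y)\<^sup>2 = 0" for y
      by (auto simp: form_def)
    then have "(\<integral>y. (form S y)\<^sup>2 * (form T y)\<^sup>2 \<partial>\<nu>) = 0"
      by (simp only: integral_zero)
    then show ?thesis using C_nonneg by (simp add: sum_nonneg)
  next
    case False
    then have pos: "0 < s" "0 < t" using nonneg by auto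
    \<comment> \<open>The weights t / s and s / t make both fourth-moment bounds equal to C s t /
      d^2.\<close>
    have amgm: "(form S y)\<^sup>2 * (form T y)\<^sup>2 \<le> (t / s * form S y ^ 4 + s / t * form T y ^ 4) / 2" for y
    proof -
      have "0 \<le> (t * (form S y)\<^sup>2 - s * (form T y)\<^sup>2)\<^sup>2 / (2 * s * t)"
        using pos by simp
      also have "\<dots> = (t / s * form S y ^ 4 + s / t * form T y ^ 4) / 2 - (form S y)\<^sup>2 * (form T y)\<^sup>2"
        using pos by (simp add: field_simps power2_eq_square power4_eq_xxxx)
      finally show ?thesis by simp
    qed
    have "(\<integral>y. (form S y)\<^sup>2 * (form T y)\<^sup>2 \<partial>\<nu>)
        \<le> (\<integral>y. (t / s * form S y ^ 4 + s / t * form T y ^ 4) / 2 \<partial>\<nu>)"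
      by (intro integral_mono integrable_bounded_measurable bounded_measurable_rules amgm)
    also have "\<dots> = (t / s * (\<integral>y. form S y ^ 4 \<partial>\<nu>) + s / t * (\<integral>y. form T y ^ 4 \<partial>\<nu>)) / 2"
      by (simp add: integrable_bounded_measurable bounded_measurable_rules)
    also have "\<dots> \<le> (t / s * (C * s\<^sup>2 / d\<^sup>2) + s / t * (C * t\<^sup>2 / d\<^sup>2)) / 2"
      unfolding s_def t_def
      by (intro divide_right_mono add_mono mult_left_mono form_moments) (auto intro!: sum_nonneg divide_nonneg_nonneg)
    also have "\<dots> = C / d\<^sup>2 * (s * t)"
      using pos by (simp add: field_simps power2_eq_square)
    finally show ?thesis by (simp add: s_def t_def)
  qed
qed

end

text \<open>A linear form in the tensor product is, for fixed x, a linear form in y whose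
  coefficients are linear forms in x. Integrating over y and then over x gives each moment from
  those of the factors, with the constants \<open>B\<close> and \<open>B'\<close>
  multiplying.\<close>

lemma isotropic_pair:
  assumes "isotropic \<nu> K g B" "isotropic \<nu>' K' g' B'"
  shows "isotropic (\<nu> \<Otimes>\<^sub>M \<nu>') (K \<times> K') (\<lambda>k z. g (fst k) (fst z) * g' (snd k) (snd z)) (B * B')"
proof -
  interpret A: isotropic \<nu> K g B by fact
  interpret B: isotropic \<nu>' K' g' B' by fact
  interpret P: pair_prob_space \<nu> \<nu>' by unfold_locales
  have meas: "(\<lambda>z. g (fst k) (fst z) * g' (snd k) (snd z)) \<in> borel_measurable (\<nu> \<Otimes>\<^sub>M \<nu>')"
    if "k \<in> K \<times> K'" for k
    using that A.h_measurable[of "fst k"] B.h_measurable[of "snd k"] by (intro borel_measurable_times) auto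
  have bdd: "\<bar>g (fst k) (fst z) * g' (snd k) (snd z)\<bar> \<le> 1"
    if "k \<in> K \<times> K'" "z \<in> space (\<nu> \<Otimes>\<^sub>M \<nu>')" for k z
    using that A.h_bounded[of "fst k" "fst z"] B.h_bounded[of "snd k" "snd z"]
    by (auto simp: abs_mult space_pair_measure intro!: mult_le_one)
  have split: "(\<Sum>k\<in>K \<times> K'. T k * (g (fst k) x * g' (snd k) y)) =
      B.form (\<lambda>b. A.form (\<lambda>a. T (a, b)) x) y" for T x y
    unfolding A.form_def B.form_def
    by (simp add: sum.cartesian_product' sum_distrib_left mult_ac) (rule sum.swap)
  have bmf: "bounded_measurable (\<nu> \<Otimes>\<^sub>M \<nu>') (\<lambda>z. \<Sum>k\<in>K \<times> K'. T k * (g (fst k) (fst z) * g' (snd k) (snd z)))" for T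
    using meas bdd by (intro bounded_measurable_intros bounded_measurableI[where B = 1]) auto
  have fubini: "(\<integral>z. (\<Sum>k\<in>K \<times> K'. T k * (g (fst k) (fst z) * g' (snd k) (snd z))) ^ m \<partial>(\<nu> \<Otimes>\<^sub>M \<nu>')) =
      (\<integral>x. (\<integral>y. B.form (\<lambda>b. A.form (\<lambda>a. T (a, b)) x) y ^ m \<partial>\<nu>') \<partial>\<nu>)" for T m
    unfolding split using bmf[unfolded split]
    by (subst P.integral_fst'[symmetric])
       (simp_all add: P.integrable_bounded_measurable bounded_measurable_power)
  have sq: "(\<Sum>k\<in>K \<times> K'. (T k)\<^sup>2) = (\<Sum>b\<in>K'. \<Sum>a\<in>K. (T (a, b))\<^sup>2)" for T :: "_ \<Rightarrow> real"
    by (subst sum.swap) (simp add: sum.cartesian_product)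
  show ?thesis
  proof unfold_locales
    show "finite (K \<times> K')" "K \<times> K' \<noteq> {}" "0 \<le> B * B'"
      using A.finite_K B.finite_K A.K_nonempty B.K_nonempty A.C_nonneg B.C_nonneg by auto
  next
    show "AE z in \<nu> \<Otimes>\<^sub>M \<nu>'. (\<Sum>k\<in>K \<times> K'. (g (fst k) (fst z) * g' (snd k) (snd z))\<^sup>2) = 1"
    proof (rule P.AE_pair_measure)
      show "{z \<in> space (\<nu> \<Otimes>\<^sub>M \<nu>'). (\<Sum>k\<in>K \<times> K'. (g (fst k) (fst z) * g' (snd k) (snd z))\<^sup>2) = 1}
          \<in> sets (\<nu> \<Otimes>\<^sub>M \<nu>')"
        using meas by (intro borel_measurable_eq borel_measurable_const borel_measurable_sum
            borel_measurable_power) auto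
      have *: "(\<Sum>k\<in>K \<times> K'. (g (fst k) x * g' (snd k) y)\<^sup>2) = (\<Sum>k\<in>K. (g k x)\<^sup>2) * (\<Sum>k\<in>K'. (g' k y)\<^sup>2)" for x y
        by (simp add: sum_product sum.cartesian_product power_mult_distrib split_beta)
      show "AE x in \<nu>. AE y in \<nu>'. (\<Sum>k\<in>K \<times> K'. (g (fst k) (fst (x, y)) * g' (snd k) (snd (x, y)))\<^sup>2) = 1"
        using A.h_norm
      proof eventually_elim
        case (elim x)
        show ?case using B.h_norm by eventually_elim (simp add: * elim)
      qed
    qed
  next
    fix T :: "'b \<times> 'd \<Rightarrow> real"
    show "(\<integral>z. (\<Sum>k\<in>K \<times> K'. T k * (g (fst k) (fst z) * g' (snd k) (snd z))) \<partial>(\<nu> \<Otimes>\<^sub>M \<nu>')) = 0"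
      using fubini[of T 1] by (simp add: B.form_moments)
    have "(\<integral>z. (\<Sum>k\<in>K \<times> K'. T k * (g (fst k) (fst z) * g' (snd k) (snd z)))\<^sup>2 \<partial>(\<nu> \<Otimes>\<^sub>M \<nu>')) =
        (\<Sum>b\<in>K'. (\<Sum>a\<in>K. (T (a, b))\<^sup>2) / A.d) / B.d"
      unfolding fubini
      by (simp add: B.form_moments A.form_moments A.integrable_bounded_measurable A.bounded_measurable_rules)
    then show "(\<integral>z. (\<Sum>k\<in>K \<times> K'. T k * (g (fst k) (fst z) * g' (snd k) (snd z)))\<^sup>2 \<partial>(\<nu> \<Otimes>\<^sub>M \<nu>')) =
        (\<Sum>k\<in>K \<times> K'. (T k)\<^sup>2) / real (card (K \<times> K'))"
      by (simp add: sq card_cartesian_product sum_divide_distrib)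
    define L where "L b = A.form (\<lambda>a. T (a, b))" for b
    define s where "s b = (\<Sum>a\<in>K. (T (a, b))\<^sup>2)" for b
    have bmL: "bounded_measurable \<nu> (L b)" for b
      unfolding L_def by (rule A.form_bounded_measurable)
    have "(\<integral>z. (\<Sum>k\<in>K \<times> K'. T k * (g (fst k) (fst z) * g' (snd k) (snd z))) ^ 4 \<partial>(\<nu> \<Otimes>\<^sub>M \<nu>')) =
        (\<integral>x. (\<integral>y. B.form (\<lambda>b. L b x) y ^ 4 \<partial>\<nu>') \<partial>\<nu>)"
      unfolding fubini L_def ..
    also have "\<dots> \<le> (\<integral>x. B' * (\<Sum>b\<in>K'. (L b x)\<^sup>2)\<^sup>2 / B.d\<^sup>2 \<partial>\<nu>)"
      using B.C_nonneg
      by (intro integral_mono' A.integrable_bounded_measurable bounded_measurable_intros bmL B.form_moments) auto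
    \<comment> \<open>Squaring the sum produces products of two squared forms in x, to which
      \<open>A.form_mixed_moment_le\<close> applies term by term.\<close>
    also have "\<dots> = B' / B.d\<^sup>2 * (\<Sum>b\<in>K'. \<Sum>c\<in>K'. (\<integral>x. (L b x)\<^sup>2 * (L c x)\<^sup>2 \<partial>\<nu>))"
      by (simp add: power2_eq_square[of "sum _ _"] sum_product A.integrable_bounded_measurable bounded_measurable_intros bmL)
    also have "\<dots> \<le> B' / B.d\<^sup>2 * (\<Sum>b\<in>K'. \<Sum>c\<in>K'. B / A.d\<^sup>2 * (s b * s c))"
      unfolding L_def s_def using B.C_nonneg by (intro mult_left_mono sum_mono A.form_mixed_moment_le) auto
    also have "\<dots> = B * B' * (\<Sum>k\<in>K \<times> K'. (T k)\<^sup>2)\<^sup>2 / (real (card (K \<times> K')))\<^sup>2"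
    proof -
      have "(\<Sum>b\<in>K'. \<Sum>c\<in>K'. B / A.d\<^sup>2 * (s b * s c)) = B / A.d\<^sup>2 * (\<Sum>b\<in>K'. s b)\<^sup>2"
        unfolding power2_eq_square sum_product by (simp only: sum_distrib_left)
      then show ?thesis
        by (simp add: sq flip: s_def) (simp add: card_cartesian_product power_mult_distrib mult_ac)
    qed
    finally show "(\<integral>z. (\<Sum>k\<in>K \<times> K'. T k * (g (fst k) (fst z) * g' (snd k) (snd z))) ^ 4 \<partial>(\<nu> \<Otimes>\<^sub>M \<nu>'))
        \<le> B * B' * (\<Sum>k\<in>K \<times> K'. (T k)\<^sup>2)\<^sup>2 / (real (card (K \<times> K')))\<^sup>2" .
  qed (use meas bdd in auto)
qed

section \<open>The uniform distribution on the sphere\<close>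

lemma space_leb: "space (leb p) = space (Rspace p)" and sets_leb [measurable_cong]: "sets (leb p) = sets (Rspace p)"
  by (auto simp: leb_def Rspace_def space_PiM cong: sets_PiM_cong)

lemma coordinate_measurable [measurable]: "i < p \<Longrightarrow> (\<lambda>x. x i) \<in> borel_measurable (Rspace p)"
  by (simp add: Rspace_def)

lemma direction_measurable [measurable]: "direction p \<in> measurable (Rspace p) (Rspace p)"
proof -
  have "(\<lambda>x. \<lambda>i\<in>{..<p}. x i / vnorm p x) \<in> measurable (Rspace p) (\<Pi>\<^sub>M i\<in>{..<p}. borel)"
    unfolding vnorm_def by measurable
  then show ?thesis by (simp add: direction_def[abs_def] Rspace_def)
qed

lemma update_measurable:
  assumes "i < p" "g \<in> borel_measurable (Rspace p)"
  shows "(\<lambda>x. x(i := g x)) \<in> measurable (Rspace p) (Rspace p)"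
proof -
  have "(\<lambda>x. \<lambda>k\<in>{..<p}. if k = i then g x else x k) \<in> measurable (Rspace p) (\<Pi>\<^sub>M i\<in>{..<p}. borel)"
    using assms(2) by measurable
  moreover have "(\<lambda>k\<in>{..<p}. if k = i then g x else x k) = x(i := g x)" if "x \<in> space (Rspace p)" for x
    using that assms(1) by (auto simp: Rspace_def space_PiM PiE_def extensional_def fun_eq_iff)
  ultimately show ?thesis
    by (subst measurable_cong[where g = "\<lambda>x. \<lambda>k\<in>{..<p}. if k = i then g x else x k"])
       (auto simp: Rspace_def)
qed

text \<open>Tonelli isolates coordinate \<open>i\<close>, and \<open>g_const\<close> says that
  \<open>g\<close> does not read it, so a one-dimensional affine substitution with Jacobian |s|
  applies. Such scalings and shears are the building blocks of the isometries below.\<close>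

lemma nn_integral_leb_affine_update:
  assumes i: "i < p" and s: "s \<noteq> 0" and g [measurable]: "g \<in> borel_measurable (Rspace p)"
    and g_const: "\<And>x y. g (x(i := y)) = g x" and f [measurable]: "f \<in> borel_measurable (Rspace p)"
  shows "(\<integral>\<^sup>+x. f x \<partial>leb p) = ennreal \<bar>s\<bar> * (\<integral>\<^sup>+x. f (x(i := s * x i + g x)) \<partial>leb p)"
proof -
  interpret product_sigma_finite "\<lambda>_::nat. lborel :: real measure" by unfold_locales
  define I where "I = {..<p} - {i}"
  have I: "finite I" "i \<notin> I" "insert i I = {..<p}"
    using i by (auto simp: I_def)
  have [measurable]: "(\<lambda>x. x(i := s * x i + g x)) \<in> measurable (Rspace p) (Rspace p)"
    using i by (intro update_measurable) auto
  have meas: "F \<in> borel_measurable (Pi\<^sub>M (insert i I) (\<lambda>_. lborel))" if "F \<in> borel_measurable (Rspace p)"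
    for F :: "_ \<Rightarrow> ennreal"
    using that measurable_cong_sets[OF sets_leb refl, of p "borel :: ennreal measure"]
    by (simp add: I leb_def)
  have "(\<integral>\<^sup>+x. f x \<partial>leb p) = (\<integral>\<^sup>+x. (\<integral>\<^sup>+y. f (x(i := y)) \<partial>lborel) \<partial>Pi\<^sub>M I (\<lambda>_. lborel))"
    using product_nn_integral_insert[OF I(1,2) meas[OF f]] by (simp add: I leb_def)
  also have "\<dots> = (\<integral>\<^sup>+x. (\<integral>\<^sup>+y. \<bar>s\<bar> * f (x(i := s * y + g x)) \<partial>lborel) \<partial>Pi\<^sub>M I (\<lambda>_. lborel))"
  proof (rule nn_integral_cong)
    fix x assume x: "x \<in> space (Pi\<^sub>M I (\<lambda>_. lborel :: real measure))"
    have "(\<lambda>y. x(i := y)) \<in> measurable lborel (Pi\<^sub>M (insert i I) (\<lambda>_. lborel))"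
      using x by (intro measurable_fun_upd[where J = I]) auto
    then have m: "(\<lambda>y. f (x(i := y))) \<in> borel_measurable borel"
      using measurable_compose[OF _ meas[OF f]] by auto
    have m': "(\<lambda>y. f (x(i := s * y + g x))) \<in> borel_measurable borel"
      by (rule measurable_compose[OF _ m]) auto
    show "(\<integral>\<^sup>+y. f (x(i := y)) \<partial>lborel) = (\<integral>\<^sup>+y. \<bar>s\<bar> * f (x(i := s * y + g x)) \<partial>lborel)"
      using nn_integral_real_affine[OF m s, of "g x"] m' by (simp add: nn_integral_cmult add.commute)
  qed
  also have "\<dots> = (\<integral>\<^sup>+x. \<bar>s\<bar> * f (x(i := s * x i + g x)) \<partial>leb p)"
    using product_nn_integral_insert[OF I(1,2) meas, of "\<lambda>x. \<bar>s\<bar> * f (x(i := s * x i + g x))"]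
    by (simp add: I leb_def g_const)
  also have "\<dots> = \<bar>s\<bar> * (\<integral>\<^sup>+x. f (x(i := s * x i + g x)) \<partial>leb p)"
    by (intro nn_integral_cmult) measurable
  finally show ?thesis .
qed

text \<open>A norm-preserving map keeps the unit ball, and one commuting with
  \<open>direction\<close> descends to the sphere. Preservation of Lebesgue measure then carries
  over to the cone measure.\<close>

lemma uniform_sphere_invariant:
  assumes G [measurable]: "G \<in> measurable (Rspace p) (Rspace p)"
    and inv: "\<And>f :: _ \<Rightarrow> ennreal. f \<in> borel_measurable (Rspace p) \<Longrightarrow>
        (\<integral>\<^sup>+x. f (G x) \<partial>leb p) = (\<integral>\<^sup>+x. f x \<partial>leb p)"
    and norm: "\<And>x. vnorm p (G x) = vnorm p x"
    and dir: "\<And>x. direction p (G x) = G (direction p x)"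
  shows "distr (uniform_sphere p) (Rspace p) G = uniform_sphere p"
proof (rule measure_eqI)
  fix A assume "A \<in> sets (distr (uniform_sphere p) (Rspace p) G)"
  then have A [measurable]: "A \<in> sets (Rspace p)" by simp
  have ball [measurable]: "unit_ball p \<in> sets (Rspace p)"
    unfolding unit_ball_def space_leb vnorm_def by measurable
  \<comment> \<open>The mass is written as an integral over the whole space so that
    \<open>inv\<close> can be applied to the integrand.\<close>
  have sph: "emeasure (uniform_sphere p) X =
      (\<integral>\<^sup>+x. indicator (unit_ball p) x * indicator X (direction p x) \<partial>leb p) / emeasure (leb p) (unit_ball p)"
    if X [measurable]: "X \<in> sets (Rspace p)" for X
  proof -
    have "emeasure (uniform_sphere p) X =
        emeasure (leb p) (unit_ball p \<inter> (direction p -` X \<inter> space (Rspace p))) / emeasure (leb p) (unit_ball p)"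
      unfolding uniform_sphere_def
      by (subst emeasure_distr) (auto simp: space_leb sets_leb)
    also have "emeasure (leb p) (unit_ball p \<inter> (direction p -` X \<inter> space (Rspace p))) =
        (\<integral>\<^sup>+x. indicator (unit_ball p \<inter> (direction p -` X \<inter> space (Rspace p))) x \<partial>leb p)"
      by (rule nn_integral_indicator[symmetric]) (simp add: sets_leb)
    also have "\<dots> = (\<integral>\<^sup>+x. indicator (unit_ball p) x * indicator X (direction p x) \<partial>leb p)"
      by (intro nn_integral_cong) (auto simp: indicator_def space_leb)
    finally show ?thesis .
  qed
  have "emeasure (distr (uniform_sphere p) (Rspace p) G) A = emeasure (uniform_sphere p) (G -` A \<inter> space (Rspace p))"
    by (subst emeasure_distr) (auto simp: uniform_sphere_def)
  also have "\<dots> = (\<integral>\<^sup>+x. indicator (unit_ball p) x * indicator (G -` A \<inter> space (Rspace p)) (direction p x) \<partial>leb p)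
      / emeasure (leb p) (unit_ball p)"
    by (rule sph) measurable
  also have "(\<integral>\<^sup>+x. indicator (unit_ball p) x * indicator (G -` A \<inter> space (Rspace p)) (direction p x) \<partial>leb p) =
      (\<integral>\<^sup>+x. indicator (unit_ball p) (G x) * indicator A (direction p (G x)) \<partial>leb p)"
    using measurable_space[OF G] measurable_space[OF direction_measurable[of p]]
    by (intro nn_integral_cong) (auto simp: indicator_def unit_ball_def norm dir space_leb)
  also have "\<dots> = (\<integral>\<^sup>+x. indicator (unit_ball p) x * indicator A (direction p x) \<partial>leb p)"
    by (rule inv) measurable
  also have "\<dots> / emeasure (leb p) (unit_ball p) = emeasure (uniform_sphere p) A"
    by (rule sph[symmetric]) measurable
  finally show "emeasure (distr (uniform_sphere p) (Rspace p) G) A = emeasure (uniform_sphere p) A" .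
qed (simp add: uniform_sphere_def)

section \<open>Sign changes and plane reflections preserve the uniform distribution\<close>

definition flip :: "nat \<Rightarrow> (nat \<Rightarrow> real) \<Rightarrow> nat \<Rightarrow> real" where
  "flip a x = x(a := - x a)"

text \<open>This is the normalised 2 x 2 Hadamard matrix acting on coordinates \<open>a\<close> and
  \<open>b\<close>. Together with the sign changes it supplies all the symmetry used for the
  moments.\<close>

definition hadamard :: "nat \<Rightarrow> nat \<Rightarrow> (nat \<Rightarrow> real) \<Rightarrow> nat \<Rightarrow> real" where
  "hadamard a b x = x(a := (x a + x b) / sqrt 2, b := (x a - x b) / sqrt 2)"

lemma flip_measurable: "a < p \<Longrightarrow> flip a \<in> measurable (Rspace p) (Rspace p)"
  unfolding flip_def[abs_def] by (intro update_measurable) auto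

lemma flip_uniform_sphere:
  assumes a: "a < p"
  shows "distr (uniform_sphere p) (Rspace p) (flip a) = uniform_sphere p"
proof (rule uniform_sphere_invariant)
  show "flip a \<in> measurable (Rspace p) (Rspace p)"
    using a by (rule flip_measurable)
  show "(\<integral>\<^sup>+x. f (flip a x) \<partial>leb p) = (\<integral>\<^sup>+x. f x \<partial>leb p)"
    if "f \<in> borel_measurable (Rspace p)" for f :: "_ \<Rightarrow> ennreal"
    using nn_integral_leb_affine_update[OF a, of "-1" "\<lambda>_. 0" f] that by (simp add: flip_def)
  show norm: "vnorm p (flip a x) = vnorm p x" for x
    unfolding vnorm_def flip_def by (intro arg_cong[where f = sqrt] sum.cong) auto
  show "direction p (flip a x) = flip a (direction p x)" for x
    using a by (auto simp: direction_def norm) (auto simp: flip_def fun_eq_iff)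
qed

context
  fixes a b p :: nat
  assumes a: "a < p" and b: "b < p" and ab: "a \<noteq> b"
begin

text \<open>The terms \<open>1 * x a\<close> and \<open>+ 0\<close> keep each factor in the shape
  \<open>s * x i + g x\<close> of \<open>nn_integral_leb_affine_update\<close>.\<close>

lemma hadamard_factor_measurable:
  "(\<lambda>x. x(a := 1 * x a + x b)) \<in> measurable (Rspace p) (Rspace p)"
  "(\<lambda>x. x(b := - sqrt 2 * x b + x a / sqrt 2)) \<in> measurable (Rspace p) (Rspace p)"
  "(\<lambda>x. x(a := 1 / sqrt 2 * x a + 0)) \<in> measurable (Rspace p) (Rspace p)"
  using a b by (auto intro!: update_measurable)

text \<open>The Jacobians of the three factors multiply to \<open>\<plusminus>1\<close>.\<close>
lemma hadamard_factorization:
  "hadamard a b x = (\<lambda>x. x(a := 1 / sqrt 2 * x a + 0))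
     ((\<lambda>x. x(b := - sqrt 2 * x b + x a / sqrt 2)) ((\<lambda>x. x(a := 1 * x a + x b)) x))"
  using ab by (auto simp: hadamard_def fun_eq_iff field_simps)

lemma hadamard_measurable: "hadamard a b \<in> measurable (Rspace p) (Rspace p)"
  unfolding hadamard_factorization[abs_def]
  by (rule measurable_compose[OF measurable_compose[OF hadamard_factor_measurable(1,2)]
        hadamard_factor_measurable(3)])

lemma hadamard_uniform_sphere: "distr (uniform_sphere p) (Rspace p) (hadamard a b) = uniform_sphere p"
proof (rule uniform_sphere_invariant[OF hadamard_measurable])
  show "(\<integral>\<^sup>+x. f (hadamard a b x) \<partial>leb p) = (\<integral>\<^sup>+x. f x \<partial>leb p)"
    if f: "f \<in> borel_measurable (Rspace p)" for f :: "_ \<Rightarrow> ennreal"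
  proof -
    \<comment> \<open>\<open>f2\<close> and \<open>f1\<close> absorb the factors from the outermost
      inwards, so that each change of variables is a single affine update.\<close>
    define f2 where "f2 x = f (x(a := 1 / sqrt 2 * x a + 0))" for x
    define f1 where "f1 x = f2 (x(b := - sqrt 2 * x b + x a / sqrt 2))" for x
    have f2: "f2 \<in> borel_measurable (Rspace p)"
      unfolding f2_def[abs_def] by (rule measurable_compose[OF hadamard_factor_measurable(3) f])
    have f1: "f1 \<in> borel_measurable (Rspace p)"
      unfolding f1_def[abs_def] by (rule measurable_compose[OF hadamard_factor_measurable(2) f2])
    have "(\<integral>\<^sup>+x. f x \<partial>leb p) = ennreal \<bar>1 / sqrt 2\<bar> * (\<integral>\<^sup>+x. f2 x \<partial>leb p)"
      unfolding f2_def using f a by (intro nn_integral_leb_affine_update) auto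
    also have "(\<integral>\<^sup>+x. f2 x \<partial>leb p) = ennreal \<bar>- sqrt 2\<bar> * (\<integral>\<^sup>+x. f1 x \<partial>leb p)"
      unfolding f1_def using f2 a b ab by (intro nn_integral_leb_affine_update) auto
    also have "(\<integral>\<^sup>+x. f1 x \<partial>leb p) = ennreal \<bar>1\<bar> * (\<integral>\<^sup>+x. f1 (x(a := 1 * x a + x b)) \<partial>leb p)"
      using f1 a b ab by (intro nn_integral_leb_affine_update) auto
    also have "(\<integral>\<^sup>+x. f1 (x(a := 1 * x a + x b)) \<partial>leb p) = (\<integral>\<^sup>+x. f (hadamard a b x) \<partial>leb p)"
      by (simp only: f1_def f2_def hadamard_factorization)
    finally show ?thesis
      by (simp flip: mult.assoc ennreal_mult)
  qed
  show norm: "vnorm p (hadamard a b x) = vnorm p x" for x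
  proof -
    \<comment> \<open>Only the coordinates \<open>a\<close> and \<open>b\<close> change, and their
      squares keep the same sum.\<close>
    have split: "(\<Sum>i<p. g i) = g a + (g b + (\<Sum>i\<in>{..<p} - {a} - {b}. g i))" for g :: "nat \<Rightarrow> real"
      using a b ab by (simp add: sum.remove[of _ a] sum.remove[of _ b])
    have "(\<Sum>i<p. (hadamard a b x i)\<^sup>2) = (\<Sum>i<p. (x i)\<^sup>2)"
      unfolding split using ab by (auto simp: hadamard_def power2_eq_square field_simps)
    then show ?thesis by (simp add: vnorm_def)
  qed
  show "direction p (hadamard a b x) = hadamard a b (direction p x)" for x
    using a b ab by (auto simp: direction_def norm)
      (auto simp: hadamard_def fun_eq_iff add_divide_distrib diff_divide_distrib mult.commute)
qed

end

section \<open>Expectations of functions of a spherical direction\<close>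

locale spherical =
  fixes p :: nat and P :: "(nat \<Rightarrow> real) measure"
  assumes p_pos: "0 < p" and spherical: "spherical_directions p P"
begin

sublocale prob_space P
  using spherical by (simp add: spherical_directions_def)

lemma sets_P [measurable_cong]: "sets P = sets (Rspace p)"
  using spherical by (simp add: spherical_directions_def)

lemma space_P: "space P = space (Rspace p)"
  by (rule sets_eq_imp_space_eq[OF sets_P])

text \<open>Integrating over \<open>P\<close> makes total mass 1 and the absence of mass at the
  origin directly available; \<open>E_eq\<close> transfers to \<open>uniform_sphere p\<close>, where
  the symmetries hold.\<close>

definition E :: "((nat \<Rightarrow> real) \<Rightarrow> real) \<Rightarrow> real" where
  "E f = (\<integral>x. f (direction p x) \<partial>P)"

lemma E_eq: "f \<in> borel_measurable (Rspace p) \<Longrightarrow> E f = (\<integral>u. f u \<partial>uniform_sphere p)"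
  using spherical integral_distr[of "direction p" P "Rspace p" f]
  by (simp add: E_def spherical_directions_def)

lemma E_invariant:
  assumes "distr (uniform_sphere p) (Rspace p) G = uniform_sphere p" "G \<in> measurable (Rspace p) (Rspace p)"
    and f: "f \<in> borel_measurable (Rspace p)"
  shows "E (\<lambda>u. f (G u)) = E f"
proof -
  have G: "G \<in> measurable (uniform_sphere p) (Rspace p)"
    using assms(2) by (simp add: uniform_sphere_def cong: measurable_cong_sets)
  have "E (\<lambda>u. f (G u)) = (\<integral>u. f (G u) \<partial>uniform_sphere p)"
    by (rule E_eq) (rule measurable_compose[OF assms(2) f])
  also have "\<dots> = (\<integral>u. f u \<partial>distr (uniform_sphere p) (Rspace p) G)"
    by (rule integral_distr[symmetric, OF G f])
  finally show ?thesis by (simp add: assms(1) E_eq f)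
qed

text \<open>Invariance under \<open>flip a\<close> gives E f = - E f.\<close>

lemma E_odd:
  assumes "a < p" "f \<in> borel_measurable (Rspace p)" "\<And>u. f (flip a u) = - f u"
  shows "E f = 0"
proof -
  from E_invariant[OF flip_uniform_sphere[OF assms(1)] flip_measurable[OF assms(1)] assms(2)]
  have "E (\<lambda>u. - f u) = E f" by (simp add: assms(3))
  then show ?thesis by (simp add: E_def)
qed

lemma E_hadamard:
  assumes "a < p" "b < p" "a \<noteq> b" "f \<in> borel_measurable (Rspace p)"
  shows "E (\<lambda>u. f (hadamard a b u)) = E f"
  using assms by (intro E_invariant hadamard_uniform_sphere hadamard_measurable)

text \<open>This includes the origin, where division by zero yields the value 0.\<close>

lemma direction_le_1: "\<bar>direction p x a\<bar> \<le> 1" if "a < p"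
proof -
  have "(x a)\<^sup>2 \<le> (\<Sum>i<p. (x i)\<^sup>2)"
    using that by (intro member_le_sum) auto
  then have "\<bar>x a\<bar> \<le> vnorm p x"
    unfolding vnorm_def by (metis real_sqrt_abs real_sqrt_le_iff)
  then show ?thesis
    using that by (auto simp: direction_def divide_le_eq_1)
qed

lemma dir_bm: "bounded_measurable P (\<lambda>x. direction p x a)" if "a < p"
proof (rule bounded_measurableI[of _ _ 1])
  show "(\<lambda>x. direction p x a) \<in> borel_measurable P"
    using that by measurable
qed (use direction_le_1 that in auto)

lemma direction_norm: "AE x in P. (\<Sum>a<p. (direction p x a)\<^sup>2) = 1"
proof -
  have "AE x in P. \<not> (\<forall>i<p. x i = 0)"
  proof (rule AE_I)
    show "emeasure P {x \<in> space (Rspace p). \<forall>i<p. x i = 0} = 0"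
      using spherical by (simp add: spherical_directions_def)
    show "{x \<in> space (Rspace p). \<forall>i<p. x i = 0} \<in> sets P"
      unfolding sets_P by measurable
  qed (auto simp: space_P)
  then show ?thesis
  proof eventually_elim
    case (elim x)
    then have "0 < (\<Sum>i<p. (x i)\<^sup>2)"
      by (metis (no_types, lifting) finite_lessThan lessThan_iff sum_pos2 zero_le_power2 zero_less_power2)
    then show ?case
      by (simp add: direction_def vnorm_def power_divide flip: sum_divide_distrib)
  qed
qed

section \<open>Second and fourth moments of the coordinates\<close>

text \<open>Reflection invariance equates E u_a^2 with E (u_a + u_b)^2 / 2, whose cross term is odd
  and vanishes.\<close>

lemma E_sq_eq:
  assumes "a < p" "b < p" shows "E (\<lambda>u. (u b)\<^sup>2) = E (\<lambda>u. (u a)\<^sup>2)"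
proof (cases "a = b")
  case False
  have "E (\<lambda>u. u a * u b) = 0"
    using assms False by (intro E_odd[of a]) (auto simp: flip_def)
  moreover have "E (\<lambda>u. (hadamard a b u a)\<^sup>2) = (E (\<lambda>u. (u a)\<^sup>2) + 2 * E (\<lambda>u. u a * u b) + E (\<lambda>u. (u b)\<^sup>2)) / 2"
    unfolding E_def using False assms
    by (simp add: hadamard_def power_divide power2_sum integrable_bounded_measurable bounded_measurable_intros dir_bm mult.assoc)
  moreover have "E (\<lambda>u. (hadamard a b u a)\<^sup>2) = E (\<lambda>u. (u a)\<^sup>2)"
    using E_hadamard[OF assms False, of "\<lambda>u. (u a)\<^sup>2"] assms by simp
  ultimately show ?thesis by simp
qed simp

text \<open>The p equal second moments sum to 1.\<close>

lemma E_sq: "E (\<lambda>u. (u a)\<^sup>2) = 1 / p" if "a < p"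
proof -
  have "(\<Sum>b<p. E (\<lambda>u. (u b)\<^sup>2)) = (\<integral>x. (\<Sum>b<p. (direction p x b)\<^sup>2) \<partial>P)"
    unfolding E_def by (subst Bochner_Integration.integral_sum)
      (auto intro!: integrable_bounded_measurable bounded_measurable_power dir_bm)
  also have "\<dots> = (\<integral>x. 1 \<partial>P)"
    using direction_norm by (intro integral_cong_AE) auto
  finally have "(\<Sum>b<p. E (\<lambda>u. (u b)\<^sup>2)) = 1" by (simp add: prob_space)
  also have "(\<Sum>b<p. E (\<lambda>u. (u b)\<^sup>2)) = (\<Sum>b<p. E (\<lambda>u. (u a)\<^sup>2))"
    using that by (intro sum.cong E_sq_eq) auto
  finally show ?thesis using p_pos by (simp add: field_simps)
qed

text \<open>Once the odd terms vanish, both reflected coordinates have fourth moment (E u_a^4 + 6 E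
  u_a^2 u_b^2 + E u_b^4) / 4. Hence the two pure moments agree, and solving gives the factor
  3.\<close>

lemma E_fourth_mixed:
  assumes "a < p" "b < p" "a \<noteq> b"
  shows "E (\<lambda>u. u a ^ 4) = 3 * E (\<lambda>u. (u a)\<^sup>2 * (u b)\<^sup>2)" and "E (\<lambda>u. u b ^ 4) = E (\<lambda>u. u a ^ 4)"
proof -
  have odd: "E (\<lambda>u. u a ^ 3 * u b) = 0" "E (\<lambda>u. u a * u b ^ 3) = 0"
    using assms by (auto intro!: E_odd[of b] simp: flip_def)
  have s4: "sqrt 2 ^ 4 = (4::real)"
    by (simp add: power4_eq_xxxx)
  have "E (\<lambda>u. (hadamard a b u a) ^ 4) = (E (\<lambda>u. u a ^ 4) + 4 * E (\<lambda>u. u a ^ 3 * u b)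
      + 6 * E (\<lambda>u. (u a)\<^sup>2 * (u b)\<^sup>2) + 4 * E (\<lambda>u. u a * u b ^ 3) + E (\<lambda>u. u b ^ 4)) / 4"
  proof -
    have *: "hadamard a b u a ^ 4 = (u a ^ 4 + 4 * (u a ^ 3 * u b) + 6 * ((u a)\<^sup>2 * (u b)\<^sup>2)
        + 4 * (u a * u b ^ 3) + u b ^ 4) / 4" for u
      using assms by (simp add: hadamard_def power_divide s4)
        (simp add: power2_eq_square power3_eq_cube power4_eq_xxxx algebra_simps)
    show ?thesis
      unfolding E_def * using assms
      by (simp add: integrable_bounded_measurable bounded_measurable_intros dir_bm)
  qed
  moreover have "E (\<lambda>u. (hadamard a b u b) ^ 4) = (E (\<lambda>u. u a ^ 4) - 4 * E (\<lambda>u. u a ^ 3 * u b)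
      + 6 * E (\<lambda>u. (u a)\<^sup>2 * (u b)\<^sup>2) - 4 * E (\<lambda>u. u a * u b ^ 3) + E (\<lambda>u. u b ^ 4)) / 4"
  proof -
    have *: "hadamard a b u b ^ 4 = (u a ^ 4 - 4 * (u a ^ 3 * u b) + 6 * ((u a)\<^sup>2 * (u b)\<^sup>2)
        - 4 * (u a * u b ^ 3) + u b ^ 4) / 4" for u
      using assms by (simp add: hadamard_def power_divide s4)
        (simp add: power2_eq_square power3_eq_cube power4_eq_xxxx algebra_simps)
    show ?thesis
      unfolding E_def * using assms
      by (simp add: integrable_bounded_measurable bounded_measurable_intros dir_bm)
  qed
  moreover have "E (\<lambda>u. (hadamard a b u a) ^ 4) = E (\<lambda>u. u a ^ 4)"
    "E (\<lambda>u. (hadamard a b u b) ^ 4) = E (\<lambda>u. u b ^ 4)"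
    using E_hadamard[OF assms, of "\<lambda>u. u a ^ 4"] E_hadamard[OF assms, of "\<lambda>u. u b ^ 4"] assms by simp_all
  ultimately show "E (\<lambda>u. u a ^ 4) = 3 * E (\<lambda>u. (u a)\<^sup>2 * (u b)\<^sup>2)" "E (\<lambda>u. u b ^ 4) = E (\<lambda>u. u a ^ 4)"
    using odd by auto
qed

text \<open>This is the mixed moment E u_a^2 u_b^2 for distinct coordinates. Defining it by a
  formula keeps it meaningful for p = 1, where 3 \<open>m22\<close> = 1 is still the fourth
  moment.\<close>

definition m22 :: real where "m22 = 1 / (real p * (real p + 2))"

text \<open>Multiplying the relation sum u_b^2 = 1 by u_a^2 and integrating gives 1 / p = m + (p -
  1) m / 3 for the fourth moment m.\<close>

lemma E_fourth: "E (\<lambda>u. u a ^ 4) = 3 * m22" if "a < p"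
proof -
  let ?m = "E (\<lambda>u. u a ^ 4)"
  have "(\<Sum>b<p. E (\<lambda>u. (u a)\<^sup>2 * (u b)\<^sup>2)) = (\<integral>x. (\<Sum>b<p. (direction p x a)\<^sup>2 * (direction p x b)\<^sup>2) \<partial>P)"
    unfolding E_def using that by (subst Bochner_Integration.integral_sum)
      (auto intro!: integrable_bounded_measurable bounded_measurable_intros dir_bm)
  also have "\<dots> = (\<integral>x. (direction p x a)\<^sup>2 \<partial>P)"
  proof (rule integral_cong_AE)
    show "AE x in P. (\<Sum>b<p. (direction p x a)\<^sup>2 * (direction p x b)\<^sup>2) = (direction p x a)\<^sup>2"
      using direction_norm by eventually_elim (simp flip: sum_distrib_left)
  qed (use that in auto)
  also have "\<dots> = 1 / p" using E_sq[OF that] by (simp add: E_def)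
  also have "(\<Sum>b<p. E (\<lambda>u. (u a)\<^sup>2 * (u b)\<^sup>2)) = ?m + (\<Sum>b\<in>{..<p} - {a}. E (\<lambda>u. (u a)\<^sup>2 * (u b)\<^sup>2))"
    using that by (subst sum.remove[of _ a]) (auto simp flip: power_add)
  also have "(\<Sum>b\<in>{..<p} - {a}. E (\<lambda>u. (u a)\<^sup>2 * (u b)\<^sup>2)) = (\<Sum>b\<in>{..<p} - {a}. ?m / 3)"
    using E_fourth_mixed(1)[OF that] by (intro sum.cong) auto
  also have "\<dots> = (real p - 1) * (?m / 3)"
    using that by (simp add: of_nat_diff)
  finally have "?m * (real p * (real p + 2)) = 3"
    using p_pos by (simp add: field_simps)
  moreover have "real p * (real p + 2) \<noteq> 0" using p_pos by simp
  ultimately show ?thesis by (simp add: m22_def eq_divide_eq)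
qed

lemma E_sq_sq: "a < p \<Longrightarrow> b < p \<Longrightarrow> a \<noteq> b \<Longrightarrow> E (\<lambda>u. (u a)\<^sup>2 * (u b)\<^sup>2) = m22"
  using E_fourth_mixed(1)[of a b] E_fourth[of a] by simp

section \<open>Moments of linear forms by induction on the number of coordinates\<close>

definition lin :: "(nat \<Rightarrow> real) \<Rightarrow> nat \<Rightarrow> (nat \<Rightarrow> real) \<Rightarrow> real" where
  "lin T k u = (\<Sum>a<k. T a * u a)"

lemma lin_Suc: "lin T (Suc k) u = lin T k u + T k * u k"
  by (simp add: lin_def)

text \<open>The truncated form stops before coordinate \<open>k\<close>, so in the inductions every
  product with an odd power of u_k has mean zero.\<close>

lemma lin_flip: "lin T k (flip k u) = lin T k u"
  unfolding lin_def flip_def by (intro sum.cong) auto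

lemma lin_measurable [measurable]: "k \<le> p \<Longrightarrow> lin T k \<in> borel_measurable (Rspace p)"
  unfolding lin_def[abs_def] by (intro borel_measurable_sum borel_measurable_times) auto

lemma lin_bm: "k \<le> p \<Longrightarrow> bounded_measurable P (\<lambda>x. lin T k (direction p x))"
  unfolding lin_def[abs_def] by (intro bounded_measurable_intros dir_bm) auto

lemmas E_simps = integrable_bounded_measurable bounded_measurable_intros dir_bm lin_bm

lemma E_lin: "k \<le> p \<Longrightarrow> E (lin T k) = 0"
proof (induction k)
  case (Suc k)
  have "E (\<lambda>u. u k) = 0"
    using Suc.prems by (intro E_odd[of k]) (auto simp: flip_def)
  moreover have "E (lin T (Suc k)) = E (lin T k) + T k * E (\<lambda>u. u k)"
    unfolding E_def lin_Suc using Suc.prems by (simp add: E_simps)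
  ultimately show ?case using Suc by simp
qed (simp add: E_def lin_def)

lemma E_lin_sq: "k \<le> p \<Longrightarrow> E (\<lambda>u. (lin T k u)\<^sup>2) = (\<Sum>a<k. (T a)\<^sup>2) / p"
proof (induction k)
  case (Suc k)
  have "E (\<lambda>u. lin T k u * u k) = 0"
    using Suc.prems by (intro E_odd[of k]) (auto simp: lin_flip, simp add: flip_def)
  moreover have "E (\<lambda>u. (lin T (Suc k) u)\<^sup>2) =
      E (\<lambda>u. (lin T k u)\<^sup>2) + 2 * T k * E (\<lambda>u. lin T k u * u k) + (T k)\<^sup>2 * E (\<lambda>u. (u k)\<^sup>2)"
  proof -
    have *: "(lin T (Suc k) u)\<^sup>2 = (lin T k u)\<^sup>2 + 2 * T k * (lin T k u * u k) + (T k)\<^sup>2 * (u k)\<^sup>2" for u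
      by (simp add: lin_Suc power2_eq_square algebra_simps)
    show ?thesis
      unfolding E_def * using Suc.prems by (simp add: E_simps)
  qed
  ultimately show ?case using Suc E_sq[of k] by (simp add: add_divide_distrib)
qed (simp add: E_def lin_def)

text \<open>The coordinate \<open>j\<close> lies outside the truncated form, so only mixed moments
  \<open>m22\<close> occur. The case j = k feeds the fourth-moment induction.\<close>

lemma E_lin_sq_coord:
  "k \<le> j \<Longrightarrow> j < p \<Longrightarrow> E (\<lambda>u. (lin T k u)\<^sup>2 * (u j)\<^sup>2) = (\<Sum>a<k. (T a)\<^sup>2) * m22"
proof (induction k)
  case (Suc k)
  have "E (\<lambda>u. lin T k u * u k * (u j)\<^sup>2) = 0"
    using Suc.prems by (intro E_odd[of k]) (auto simp: lin_flip, simp add: flip_def)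
  moreover have "E (\<lambda>u. (lin T (Suc k) u)\<^sup>2 * (u j)\<^sup>2) = E (\<lambda>u. (lin T k u)\<^sup>2 * (u j)\<^sup>2)
      + 2 * T k * E (\<lambda>u. lin T k u * u k * (u j)\<^sup>2) + (T k)\<^sup>2 * E (\<lambda>u. (u k)\<^sup>2 * (u j)\<^sup>2)"
  proof -
    have *: "(lin T (Suc k) u)\<^sup>2 * (u j)\<^sup>2 = (lin T k u)\<^sup>2 * (u j)\<^sup>2
        + 2 * T k * (lin T k u * u k * (u j)\<^sup>2) + (T k)\<^sup>2 * ((u k)\<^sup>2 * (u j)\<^sup>2)" for u
      by (simp add: lin_Suc power2_eq_square algebra_simps)
    show ?thesis
      unfolding E_def * using Suc.prems by (simp add: E_simps)
  qed
  ultimately show ?case using Suc E_sq_sq[of k j] by (simp add: ring_distribs)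
qed (simp add: E_def lin_def)

text \<open>With S the sum of the first k squared coefficients, the binomial expansion leaves 3
  \<open>m22\<close> (S^2 + 2 S T_k^2 + T_k^4), a perfect square again.\<close>

lemma E_lin_fourth: "k \<le> p \<Longrightarrow> E (\<lambda>u. lin T k u ^ 4) = 3 * m22 * (\<Sum>a<k. (T a)\<^sup>2)\<^sup>2"
proof (induction k)
  case (Suc k)
  have "E (\<lambda>u. lin T k u ^ 3 * u k) = 0" "E (\<lambda>u. lin T k u * u k ^ 3) = 0"
    using Suc.prems by (auto intro!: E_odd[of k] simp: lin_flip) (simp_all add: flip_def)
  moreover have "E (\<lambda>u. lin T (Suc k) u ^ 4) = E (\<lambda>u. lin T k u ^ 4)
      + 4 * T k * E (\<lambda>u. lin T k u ^ 3 * u k) + 6 * (T k)\<^sup>2 * E (\<lambda>u. (lin T k u)\<^sup>2 * (u k)\<^sup>2)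
      + 4 * T k ^ 3 * E (\<lambda>u. lin T k u * u k ^ 3) + T k ^ 4 * E (\<lambda>u. u k ^ 4)"
  proof -
    have *: "lin T (Suc k) u ^ 4 = lin T k u ^ 4
      + 4 * T k * (lin T k u ^ 3 * u k) + 6 * (T k)\<^sup>2 * ((lin T k u)\<^sup>2 * (u k)\<^sup>2)
      + 4 * T k ^ 3 * (lin T k u * u k ^ 3) + T k ^ 4 * u k ^ 4" for u
      by (simp add: lin_Suc power2_eq_square power3_eq_cube power4_eq_xxxx algebra_simps)
    show ?thesis
      unfolding E_def * using Suc.prems by (simp add: E_simps)
  qed
  ultimately have "E (\<lambda>u. lin T (Suc k) u ^ 4) = 3 * m22 * (\<Sum>a<k. (T a)\<^sup>2)\<^sup>2
      + 6 * (T k)\<^sup>2 * ((\<Sum>a<k. (T a)\<^sup>2) * m22) + T k ^ 4 * (3 * m22)"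
    using Suc E_lin_sq_coord[of k k T] E_fourth[of k] by simp
  then show ?case
    by (simp add: power2_eq_square power4_eq_xxxx algebra_simps)
qed (simp add: E_def lin_def)

text \<open>The constant 3 comes from \<open>m22\<close> <= 1 / p^2.\<close>

lemma isotropic: "isotropic P {..<p} (\<lambda>a x. direction p x a) 3"
proof
  fix T :: "nat \<Rightarrow> real"
  show "(\<integral>x. (\<Sum>k<p. T k * direction p x k) \<partial>P) = 0"
    using E_lin[of p T] by (simp add: E_def lin_def)
  show "(\<integral>x. (\<Sum>k<p. T k * direction p x k)\<^sup>2 \<partial>P) = (\<Sum>k<p. (T k)\<^sup>2) / real (card {..<p})"
    using E_lin_sq[of p T] by (simp add: E_def lin_def)
  have "(\<integral>x. (\<Sum>k<p. T k * direction p x k) ^ 4 \<partial>P) = 3 * m22 * (\<Sum>k<p. (T k)\<^sup>2)\<^sup>2"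
    using E_lin_fourth[of p T] by (simp add: E_def lin_def)
  also have "\<dots> \<le> 3 * (1 / (real p)\<^sup>2) * (\<Sum>k<p. (T k)\<^sup>2)\<^sup>2"
    unfolding m22_def power2_eq_square[of "real p"] using p_pos
    by (intro mult_right_mono mult_left_mono divide_left_mono) auto
  finally show "(\<integral>x. (\<Sum>k<p. T k * direction p x k) ^ 4 \<partial>P) \<le> 3 * (\<Sum>k<p. (T k)\<^sup>2)\<^sup>2 / (real (card {..<p}))\<^sup>2"
    by simp
qed (use p_pos direction_norm direction_le_1 dir_bm in \<open>auto simp: bounded_measurable_def\<close>)

end

section \<open>The standardized statistic\<close>

lemma sum_square_symmetric:
  fixes f :: "nat \<Rightarrow> nat \<Rightarrow> real"
  assumes "\<And>i j. f i j = f j i"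
  shows "(\<Sum>i<n. \<Sum>j<n. f i j) = (\<Sum>i<n. f i i) + 2 * (\<Sum>j<n. \<Sum>i<j. f i j)"
proof (induction n)
  case (Suc n)
  have "(\<Sum>j<n. f n j) = (\<Sum>j<n. f j n)"
    using assms by simp
  with Suc show ?case by (simp add: sum.distrib)
qed simp

lemma vinner_commute: "vinner p x y = vinner p y x"
  by (simp add: vinner_def mult.commute)

text \<open>The diagonal of the double sum is exactly n, so it contributes p q to
  \<open>I_stat\<close> and cancels the centring; symmetry doubles the rest.\<close>

lemma I_St_eq:
  assumes "0 < p" "0 < q" "0 < n"
    and "\<And>i. i < n \<Longrightarrow> vinner p (U i) (U i) = 1" "\<And>i. i < n \<Longrightarrow> vinner q (V i) (V i) = 1"
  shows "I_St p q n U V = sqrt (2 * real (p * q)) / real n *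
    (\<Sum>j<n. \<Sum>i<j. vinner p (U i) (U j) * vinner q (V i) (V j))"
proof -
  define W where "W = (\<Sum>j<n. \<Sum>i<j. vinner p (U i) (U j) * vinner q (V i) (V j))"
  define r where "r = sqrt (2 * real (p * q))"
  have r: "0 < r" "real (p * q) = r * r / 2"
    using assms by (auto simp: r_def)
  have "(\<Sum>i<n. \<Sum>j<n. vinner p (U i) (U j) * vinner q (V i) (V j)) =
      (\<Sum>i<n. vinner p (U i) (U i) * vinner q (V i) (V i)) + 2 * W"
    unfolding W_def by (rule sum_square_symmetric) (simp add: vinner_commute)
  also have "(\<Sum>i<n. vinner p (U i) (U i) * vinner q (V i) (V i)) = n"
    using assms by simp
  finally have "I_stat p q n U V - real (p * q) = real (p * q) / n * (2 * W)"
    unfolding I_stat_def using assms(3) by (simp only:) (simp add: field_simps)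
  then show ?thesis
    unfolding I_St_def W_def[symmetric] r_def[symmetric] r(2) using r(1) by (simp add: field_simps)
qed

section \<open>One row of the triangular array\<close>

locale spherical_sample = prob_space M for M :: "'a measure" +
  fixes p q n :: nat and X Y :: "nat \<Rightarrow> 'a \<Rightarrow> nat \<Rightarrow> real"
  assumes p_pos: "0 < p" and q_pos: "0 < q" and n_pos: "0 < n"
    and X_measurable: "i < n \<Longrightarrow> X i \<in> measurable M (Rspace p)"
    and Y_measurable: "i < n \<Longrightarrow> Y i \<in> measurable M (Rspace q)"
    and indep: "indep_vars (\<lambda>i. Rspace p \<Otimes>\<^sub>M Rspace q) (\<lambda>i \<omega>. (X i \<omega>, Y i \<omega>)) {..<n}"
    and ident: "i < n \<Longrightarrow> distr M (Rspace p \<Otimes>\<^sub>M Rspace q) (\<lambda>\<omega>. (X i \<omega>, Y i \<omega>)) =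
      distr M (Rspace p \<Otimes>\<^sub>M Rspace q) (\<lambda>\<omega>. (X 0 \<omega>, Y 0 \<omega>))"
    and XY_indep: "i < n \<Longrightarrow> indep_var (Rspace p) (X i) (Rspace q) (Y i)"
    and X_spherical: "i < n \<Longrightarrow> spherical_directions p (distr M (Rspace p) (X i))"
    and Y_spherical: "i < n \<Longrightarrow> spherical_directions q (distr M (Rspace q) (Y i))"
begin

definition stat :: "'a \<Rightarrow> real" where
  "stat \<omega> = I_St p q n (\<lambda>i. direction p (X i \<omega>)) (\<lambda>i. direction q (Y i \<omega>))"

definition offdiag :: "'a \<Rightarrow> real" where
  "offdiag \<omega> = (\<Sum>j<n. \<Sum>i<j. vinner p (direction p (X i \<omega>)) (direction p (X j \<omega>)) *
     vinner q (direction q (Y i \<omega>)) (direction q (Y j \<omega>)))"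

lemma AE_direction_norm:
  assumes "0 < k" "Z \<in> measurable M (Rspace k)" "spherical_directions k (distr M (Rspace k) Z)"
  shows "AE \<omega> in M. vinner k (direction k (Z \<omega>)) (direction k (Z \<omega>)) = 1"
proof -
  interpret S: spherical k "distr M (Rspace k) Z" using assms by unfold_locales
  have "AE x in distr M (Rspace k) Z. (\<Sum>a<k. (direction k x a)\<^sup>2) = 1"
    by (rule S.direction_norm)
  then have "AE \<omega> in M. (\<Sum>a<k. (direction k (Z \<omega>) a)\<^sup>2) = 1"
    using assms(2) by (subst (asm) AE_distr_iff) auto
  then show ?thesis by (simp add: vinner_def power2_eq_square)
qed

text \<open>The identity may fail only where some observation is the origin, a null event.\<close>

lemma AE_stat: "AE \<omega> in M. stat \<omega> = sqrt (2 * real (p * q)) / real n * offdiag \<omega>"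
proof -
  have "AE \<omega> in M. \<forall>i\<in>{..<n}. vinner p (direction p (X i \<omega>)) (direction p (X i \<omega>)) = 1"
    using p_pos by (intro AE_finite_allI AE_direction_norm X_measurable X_spherical) auto
  moreover have "AE \<omega> in M. \<forall>i\<in>{..<n}. vinner q (direction q (Y i \<omega>)) (direction q (Y i \<omega>)) = 1"
    using q_pos by (intro AE_finite_allI AE_direction_norm Y_measurable Y_spherical) auto
  ultimately show ?thesis
    by eventually_elim (unfold stat_def offdiag_def, intro I_St_eq, use p_pos q_pos n_pos in auto)
qed

lemma vinner_direction_measurable:
  assumes "Z \<in> measurable M (Rspace k)" "Z' \<in> measurable M (Rspace k)"
  shows "(\<lambda>\<omega>. vinner k (direction k (Z \<omega>)) (direction k (Z' \<omega>))) \<in> borel_measurable M"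
  unfolding vinner_def using assms by measurable

lemma stat_measurable [measurable]: "stat \<in> borel_measurable M"
  unfolding stat_def[abs_def] I_St_def I_stat_def
  by (intro borel_measurable_divide borel_measurable_diff borel_measurable_times borel_measurable_sum
      borel_measurable_const vinner_direction_measurable X_measurable Y_measurable) auto

lemma offdiag_measurable [measurable]: "offdiag \<in> borel_measurable M"
  unfolding offdiag_def[abs_def]
  by (intro borel_measurable_times borel_measurable_sum vinner_direction_measurable
      X_measurable Y_measurable) auto

text \<open>Index 0 belongs to the row because n > 0, and by \<open>ident\<close> it represents the
  common law.\<close>

definition law :: "((nat \<Rightarrow> real) \<times> (nat \<Rightarrow> real)) measure" where
  "law = distr M (Rspace p \<Otimes>\<^sub>M Rspace q) (\<lambda>\<omega>. (X 0 \<omega>, Y 0 \<omega>))"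

sublocale law: isotropic law "{..<p} \<times> {..<q}"
  "\<lambda>k z. direction p (fst z) (fst k) * direction q (snd z) (snd k)" "3 * 3"
proof -
  have law: "law = distr M (Rspace p) (X 0) \<Otimes>\<^sub>M distr M (Rspace q) (Y 0)"
    using XY_indep[OF n_pos] unfolding indep_var_distribution_eq law_def by simp
  show "isotropic law ({..<p} \<times> {..<q})
      (\<lambda>k z. direction p (fst z) (fst k) * direction q (snd z) (snd k)) (3 * 3)"
    unfolding law using p_pos q_pos n_pos X_spherical Y_spherical
    by (intro isotropic_pair spherical.isotropic spherical.intro)
qed

lemma card_index: "real (card ({..<p} \<times> {..<q})) = real (p * q)"
  by (simp add: card_cartesian_product)

definition sample :: "'a \<Rightarrow> nat \<Rightarrow> (nat \<Rightarrow> real) \<times> (nat \<Rightarrow> real)" where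
  "sample \<omega> = (\<lambda>i\<in>{..<n}. (X i \<omega>, Y i \<omega>))"

lemma distr_sample: "distr M (\<Pi>\<^sub>M i\<in>{..<n}. Rspace p \<Otimes>\<^sub>M Rspace q) sample = law.Prod n"
proof -
  have "distr M (\<Pi>\<^sub>M i\<in>{..<n}. Rspace p \<Otimes>\<^sub>M Rspace q) sample =
      (\<Pi>\<^sub>M i\<in>{..<n}. distr M (Rspace p \<Otimes>\<^sub>M Rspace q) (\<lambda>\<omega>. (X i \<omega>, Y i \<omega>)))"
    unfolding sample_def[abs_def]
    by (rule indep_vars_iff_distr_eq_PiM'[THEN iffD1, OF _ _ indep])
       (use n_pos X_measurable Y_measurable in auto)
  also have "\<dots> = law.Prod n"
    unfolding law.Prod_def unfolding law_def by (intro PiM_cong refl ident) simp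
  finally show ?thesis .
qed

text \<open>This rests on <u (x) v, u' (x) v'> = <u, u'> <v, v'>, where (x) is the tensor
  product.\<close>

lemma ustat_sample: "law.ustat n (sample \<omega>) = offdiag \<omega>"
  unfolding law.ustat_def offdiag_def
proof (intro sum.cong refl)
  fix j assume "j \<in> {..<n}"
  then have j: "j < n" by simp
  let ?h = "\<lambda>k i. direction p (X i \<omega>) (fst k) * direction q (Y i \<omega>) (snd k)"
  have "law.form (law.walk j (sample \<omega>)) (sample \<omega> j) =
      (\<Sum>k\<in>{..<p} \<times> {..<q}. (\<Sum>i<j. ?h k i) * ?h k j)"
    unfolding law.form_def law.walk_def
    using j by (intro sum.cong arg_cong2[where f = "(*)"]) (auto simp: sample_def)
  also have "\<dots> = (\<Sum>i<j. \<Sum>k\<in>{..<p} \<times> {..<q}. ?h k i * ?h k j)"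
    unfolding sum_distrib_right by (rule sum.swap)
  also have "\<dots> = (\<Sum>i<j. vinner p (direction p (X i \<omega>)) (direction p (X j \<omega>)) *
      vinner q (direction q (Y i \<omega>)) (direction q (Y j \<omega>)))"
    unfolding vinner_def sum_product sum.cartesian_product by (intro sum.cong) (auto simp: mult_ac)
  finally show "law.form (law.walk j (sample \<omega>)) (sample \<omega> j) = \<dots>" .
qed

text \<open>Almost everywhere \<open>stat\<close> is the scaled off-diagonal sum, a function of
  \<open>sample\<close>; independence and identical distribution make the law of
  \<open>sample\<close> a product measure.\<close>

lemma char_stat: "char (distr M borel stat) t = law.cf n t n"
proof -
  have "char (distr M borel stat) t = (\<integral>\<omega>. iexp (t * stat \<omega>) \<partial>M)"
    unfolding char_def by (rule integral_distr) auto
  also have "\<dots> = (\<integral>\<omega>. iexp (t * (sqrt (2 * real (p * q)) / real n * law.ustat n (sample \<omega>))) \<partial>M)"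
    unfolding ustat_sample
  proof (rule integral_cong_AE)
    show "AE \<omega> in M. iexp (t * stat \<omega>) = iexp (t * (sqrt (2 * real (p * q)) / real n * offdiag \<omega>))"
      using AE_stat by eventually_elim simp
  qed auto
  also have "\<dots> = (\<integral>x. iexp (t * (sqrt (2 * real (p * q)) / real n * law.ustat n x))
      \<partial>distr M (\<Pi>\<^sub>M i\<in>{..<n}. Rspace p \<Otimes>\<^sub>M Rspace q) sample)"
  proof (rule integral_distr[symmetric])
    show "sample \<in> measurable M (\<Pi>\<^sub>M i\<in>{..<n}. Rspace p \<Otimes>\<^sub>M Rspace q)"
      unfolding sample_def[abs_def] using X_measurable Y_measurable by (intro measurable_restrict) auto
    \<comment> \<open>The image measure in \<open>distr_sample\<close> shows that
      \<open>law.Prod n\<close> carries the same sigma-algebra as the product of the coordinate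
      spaces.\<close>
    have "law.ustat n \<in> borel_measurable (law.Prod n)"
      using law.ustat_bounded_measurable[of n n] by (simp add: bounded_measurable_def)
    then have [measurable]: "law.ustat n \<in> borel_measurable (\<Pi>\<^sub>M i\<in>{..<n}. Rspace p \<Otimes>\<^sub>M Rspace q)"
      unfolding distr_sample[symmetric] by simp
    show "(\<lambda>x. iexp (t * (sqrt (2 * real (p * q)) / real n * law.ustat n x)))
        \<in> borel_measurable (\<Pi>\<^sub>M i\<in>{..<n}. Rspace p \<Otimes>\<^sub>M Rspace q)"
      by measurable
  qed
  also have "\<dots> = law.cf n t n"
    unfolding distr_sample law.cf_def card_index ..
  finally show ?thesis .
qed

text \<open>Here 55 is 1 + 6 C with C = 3 * 3 for the tensor product of two sphere
  directions.\<close>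

lemma char_stat_le:
  "cmod (char (distr M borel stat) t - complex_of_real (exp (- (t\<^sup>2 / 2 * (1 - 1 / n)))))
    \<le> 3 / 2 * t\<^sup>2 / sqrt (real (p * q)) + t ^ 4 / (2 * real n) + \<bar>t\<bar> ^ 3 * 55 / (6 * sqrt n)"
  using law.cf_final_le[OF n_pos, of t] unfolding char_stat card_index by simp

end

section \<open>Convergence in distribution\<close>

theorem theorem5:
  fixes p q :: "nat \<Rightarrow> nat"
    and M :: "nat \<Rightarrow> 'a measure"
    and X Y :: "nat \<Rightarrow> nat \<Rightarrow> 'a \<Rightarrow> (nat \<Rightarrow> real)"
  assumes ppos: "\<And>n. p n > 0" and qpos: "\<And>n. q n > 0"
    and maxlim: "filterlim (\<lambda>n. max (p n) (q n)) at_top sequentially"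
    and prob: "\<And>n. prob_space (M n)"
    and Xmeas: "\<And>n i. i < n \<Longrightarrow> X n i \<in> measurable (M n) (Rspace (p n))"
    and Ymeas: "\<And>n i. i < n \<Longrightarrow> Y n i \<in> measurable (M n) (Rspace (q n))"
    and indep: "\<And>n. prob_space.indep_vars (M n) (\<lambda>i. Rspace (p n) \<Otimes>\<^sub>M Rspace (q n))
                  (\<lambda>i \<omega>. (X n i \<omega>, Y n i \<omega>)) {..<n}"
    and ident: "\<And>n i. i < n \<Longrightarrow>
                  distr (M n) (Rspace (p n) \<Otimes>\<^sub>M Rspace (q n)) (\<lambda>\<omega>. (X n i \<omega>, Y n i \<omega>)) =
                  distr (M n) (Rspace (p n) \<Otimes>\<^sub>M Rspace (q n)) (\<lambda>\<omega>. (X n 0 \<omega>, Y n 0 \<omega>))"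
    and XYindep: "\<And>n i. i < n \<Longrightarrow>
                  prob_space.indep_var (M n) (Rspace (p n)) (X n i) (Rspace (q n)) (Y n i)"
    and Xsph: "\<And>n i. i < n \<Longrightarrow> spherical_directions (p n) (distr (M n) (Rspace (p n)) (X n i))"
    and Ysph: "\<And>n i. i < n \<Longrightarrow> spherical_directions (q n) (distr (M n) (Rspace (q n)) (Y n i))"
  shows "(\<forall>n\<ge>1. AE \<omega> in M n.
            I_St (p n) (q n) n (\<lambda>i. direction (p n) (X n i \<omega>)) (\<lambda>i. direction (q n) (Y n i \<omega>)) =
            sqrt (2 * real (p n * q n)) / real n *
              (\<Sum>j<n. \<Sum>i<j. vinner (p n) (direction (p n) (X n i \<omega>)) (direction (p n) (X n j \<omega>)) *
                             vinner (q n) (direction (q n) (Y n i \<omega>)) (direction (q n) (Y n j \<omega>))))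
     \<and> weak_conv_m
         (\<lambda>n. distr (M n) borel
            (\<lambda>\<omega>. I_St (p n) (q n) n (\<lambda>i. direction (p n) (X n i \<omega>)) (\<lambda>i. direction (q n) (Y n i \<omega>))))
         std_normal_distribution"
proof -
  have sample: "spherical_sample (M n) (p n) (q n) n (X n) (Y n)" if "0 < n" for n
    by (intro spherical_sample.intro spherical_sample_axioms.intro; (rule assms that)?; assumption?)
  let ?S = "\<lambda>n \<omega>. I_St (p n) (q n) n (\<lambda>i. direction (p n) (X n i \<omega>)) (\<lambda>i. direction (q n) (Y n i \<omega>))"
  have "AE \<omega> in M n. ?S n \<omega> = sqrt (2 * real (p n * q n)) / real n *
      (\<Sum>j<n. \<Sum>i<j. vinner (p n) (direction (p n) (X n i \<omega>)) (direction (p n) (X n j \<omega>)) *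
         vinner (q n) (direction (q n) (Y n i \<omega>)) (direction (q n) (Y n j \<omega>)))" if "1 \<le> n" for n
  proof -
    interpret spherical_sample "M n" "p n" "q n" n "X n" "Y n" using that by (intro sample) simp
    show ?thesis using AE_stat unfolding stat_def offdiag_def .
  qed
  moreover have "weak_conv_m (\<lambda>n. distr (M n) borel (?S n)) std_normal_distribution"
  proof (rule levy_continuity)
    show "real_distribution (distr (M n) borel (?S n))" for n
    \<comment> \<open>Levy's theorem asks for a distribution at every index; in the empty row n = 0
      the statistic is a constant.\<close>
    proof (cases "n = 0")
      case True
      interpret prob_space "M n" by (rule prob)
      show ?thesis
        using True by (intro real_distribution_distr) (simp add: I_St_def I_stat_def)
    next
      case False
      interpret spherical_sample "M n" "p n" "q n" n "X n" "Y n" using False by (intro sample) simp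
      show ?thesis using real_distribution_distr[OF stat_measurable] by (simp add: stat_def[abs_def])
    qed
    show "real_distribution std_normal_distribution" by (rule real_dist_normal_dist)
    fix t
    let ?e = "\<lambda>n. complex_of_real (exp (- (t\<^sup>2 / 2 * (1 - 1 / real n))))"
    let ?b = "\<lambda>n. 3 / 2 * t\<^sup>2 / sqrt (real (p n * q n)) + t ^ 4 / (2 * real n) + \<bar>t\<bar> ^ 3 * 55 / (6 * sqrt n)"
    have d: "filterlim (\<lambda>n. sqrt (real (p n * q n))) at_top sequentially"
    proof (rule filterlim_compose[OF sqrt_at_top], rule filterlim_at_top_mono)
      show "filterlim (\<lambda>n. real (max (p n) (q n))) at_top sequentially"
        by (rule filterlim_compose[OF filterlim_real_sequentially maxlim])
      \<comment> \<open>Since both dimensions are at least 1, divergence of their maximum forces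
        divergence of d = p q.\<close>
      have "max (p n) (q n) \<le> p n * q n" for n
        using ppos[of n] qpos[of n] by auto
      then show "\<forall>\<^sub>F n in sequentially. real (max (p n) (q n)) \<le> real (p n * q n)"
        by (intro always_eventually allI of_nat_mono)
    qed
    have "?b \<longlonglongrightarrow> 0 + 0 + 0"
    proof (intro tendsto_add)
      show "(\<lambda>n. 3 / 2 * t\<^sup>2 / sqrt (real (p n * q n))) \<longlonglongrightarrow> 0"
        by (rule real_tendsto_divide_at_top[OF tendsto_const d])
      show "(\<lambda>n. t ^ 4 / (2 * real n)) \<longlonglongrightarrow> 0"
        by (intro real_tendsto_divide_at_top[OF tendsto_const]
            filterlim_tendsto_pos_mult_at_top[OF tendsto_const] filterlim_real_sequentially) simp
      show "(\<lambda>n. \<bar>t\<bar> ^ 3 * 55 / (6 * sqrt n)) \<longlonglongrightarrow> 0"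
        by (intro real_tendsto_divide_at_top[OF tendsto_const]
            filterlim_tendsto_pos_mult_at_top[OF tendsto_const]
            filterlim_compose[OF sqrt_at_top] filterlim_real_sequentially) simp
    qed
    then have b: "?b \<longlonglongrightarrow> 0" by simp
    have "(\<lambda>n. char (distr (M n) borel (?S n)) t - ?e n) \<longlonglongrightarrow> 0"
    proof (rule Lim_null_comparison[OF _ b])
      show "\<forall>\<^sub>F n in sequentially. cmod (char (distr (M n) borel (?S n)) t - ?e n) \<le> ?b n"
        using eventually_gt_at_top[of 0]
      proof eventually_elim
        case (elim n)
        interpret spherical_sample "M n" "p n" "q n" n "X n" "Y n" using elim by (rule sample)
        show ?case using char_stat_le[of t] unfolding stat_def[abs_def] .
      qed
    qed
    \<comment> \<open>The comparison variance 1 - 1 / n tends to 1.\<close>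
    moreover have "?e \<longlonglongrightarrow> complex_of_real (exp (- (t\<^sup>2 / 2 * (1 - 0))))"
      by (intro tendsto_intros lim_1_over_n)
    ultimately have "(\<lambda>n. (char (distr (M n) borel (?S n)) t - ?e n) + ?e n)
        \<longlonglongrightarrow> 0 + complex_of_real (exp (- (t\<^sup>2 / 2 * (1 - 0))))"
      by (rule tendsto_add)
    then show "(\<lambda>n. char (distr (M n) borel (?S n)) t) \<longlonglongrightarrow> char std_normal_distribution t"
      by (simp add: char_std_normal_distribution)
  qed
  ultimately show ?thesis by blast
qed

end
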